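(* Let $(X,\|\cdot\|)$ be a complex Banach space, $M,m\in\mathbb N$ with $m>M\ge1$, $a<b$, and let $F\colon[a,b]\to X$ be $2M$ times differentiable with $\|F^{(2M)}(x)\|\le A$ for all $x\in[a,b]$. Then $$\Bigl\|\frac{b-a}{m-1}\sum_{j=0}^{m-1}F(y_j)-\frac{m(b-a)}{2(m-1)}S_M(F)\Bigr\|\le\frac{12A(b-a)^{2M+1}(M!)^4}{(2M+1)((2M)!)^3}.$$
   Context: Let $x_j=-1+\frac{2j}{m-1}$, $0\le j\le m-1$. The Gram polynomials $p_{n,m}$ ($n<m$) are the polynomials of degree $n$ with positive leading coefficient $a_{n,m}$ that are orthonormal for the discrete inner product on the points $x_j$: $\sum_{j=0}^{m-1}p_{n,m}(x_j)p_{k,m}(x_j)=\delta_{nk}$. Let $\xi_{1,m},\dots,\xi_{M,m}$ be the zeros of $p_{M,m}$ and $\omega_{k,m}=\frac{a_{M,m}}{a_{M-1,m}}\cdot\frac{2}{m\,p'_{M,m}(\xi_{k,m})\,p_{M-1,m}(\xi_{k,m})}$. With $\ell(x)=\frac{b-a}2(x+1)+a$, set $y_j=\ell(x_j)$, $\eta_{k,m}=\ell(\xi_{k,m})$ and $S_M(F)=\sum_{k=1}^M\omega_{k,m}F(\eta_{k,m})$. *)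

theory Defs
  imports "HOL-Analysis.Analysis" "HOL-Computational_Algebra.Polynomial"
begin

definition gram_node :: "nat \<Rightarrow> nat \<Rightarrow> real" where
  "gram_node m j = -1 + 2 * real j / (real m - 1)"

text \<open>A family of Gram polynomials for the m nodes: for n < m, p n has degree n,
  positive leading coefficient, and the family is orthonormal for the discrete inner
  product; for n >= m we normalise p n = 0 so that the family is unique.\<close>
definition is_gram_family :: "nat \<Rightarrow> (nat \<Rightarrow> real poly) \<Rightarrow> bool" where
  "is_gram_family m p \<longleftrightarrow>
     (\<forall>n<m. degree (p n) = n \<and> lead_coeff (p n) > 0) \<and>
     (\<forall>n<m. \<forall>k<m. (\<Sum>j<m. poly (p n) (gram_node m j) * poly (p k) (gram_node m j))
                   = (if n = k then 1 else 0)) \<and>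
     (\<forall>n\<ge>m. p n = 0)"

definition gram_poly :: "nat \<Rightarrow> nat \<Rightarrow> real poly" where
  "gram_poly m n = (THE p. is_gram_family m p) n"

definition gram_lc :: "nat \<Rightarrow> nat \<Rightarrow> real" where
  "gram_lc m n = lead_coeff (gram_poly m n)"

definition gram_weight :: "nat \<Rightarrow> nat \<Rightarrow> real \<Rightarrow> real" where
  "gram_weight m M \<xi> = gram_lc m M / gram_lc m (M - 1) *
     (2 / (real m * poly (pderiv (gram_poly m M)) \<xi> * poly (gram_poly m (M - 1)) \<xi>))"

definition affine_ab :: "real \<Rightarrow> real \<Rightarrow> real \<Rightarrow> real" where
  "affine_ab a b x = (b - a) / 2 * (x + 1) + a"

definition gram_quad :: "nat \<Rightarrow> nat \<Rightarrow> real \<Rightarrow> real \<Rightarrow> (real \<Rightarrow> 'a::real_vector) \<Rightarrow> 'a" where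
  "gram_quad m M a b F =
     (\<Sum>\<xi>\<in>{x. poly (gram_poly m M) x = 0}. gram_weight m M \<xi> *\<^sub>R F (affine_ab a b \<xi>))"

end

theory Submission
  imports Defs
begin

text \<open>
  The quadrature rule is the Gauss rule of the discrete measure \<open>\<Sum>\<^sub>j \<delta>(x\<^sub>j)\<close>, hence exact for
  polynomials of degree below \<open>2 M\<close>. A norming functional (Hahn--Banach) reduces the claim to real
  functions. Subtracting the Hermite interpolant at the zeros of \<open>p\<^sub>M\<close> from a real \<open>f\<close> leaves a
  remainder bounded by \<open>sup \<bar>f\<^bsup>(2M)\<^esup>\<bar> / (2M)! \<cdot> (p\<^sub>M / a\<^sub>M)\<^sup>2\<close>, so the error is at most
  \<open>sup \<bar>f\<^bsup>(2M)\<^esup>\<bar> / ((2M)! a\<^sub>M\<^sup>2)\<close>. The Gram polynomials are rescaled discrete Chebyshev polynomials,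
  whose norms follow from their Rodrigues formula by summation by parts; this gives \<open>a\<^sub>M\<close> exactly, and
  the remaining factor \<open>m \<Prod>\<^bsub>i \<le> M\<^esub> (m\<^sup>2 - i\<^sup>2) / (m - 1)\<^bsup>2M+1\<^esup>\<close> is at most
  \<open>(m / (m - 1))\<^bsup>2m-1\<^esup> \<le> 12\<close>.
\<close>

section \<open>Norming functionals\<close>

text \<open>Homogeneity is demanded only as an inequality for positive scalars, which is easy to
  check for infima. Scaling back by \<open>1 / c\<close> turns it into an equality.\<close>

definition sublinear :: "('a::real_vector \<Rightarrow> real) \<Rightarrow> bool" where
  "sublinear q \<longleftrightarrow> (\<forall>x y. q (x + y) \<le> q x + q y) \<and> (\<forall>c>0. \<forall>x. q (c *\<^sub>R x) \<le> c * q x)"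

lemma sublinearD:
  assumes "sublinear q"
  shows "q (x + y) \<le> q x + q y" and "c > 0 \<Longrightarrow> q (c *\<^sub>R x) = c * q x"
    and "q 0 = 0" and "- q (- x) \<le> q x"
proof -
  show add: "q (x + y) \<le> q x + q y" for x y
    using assms by (auto simp: sublinear_def)
  have le: "q (c *\<^sub>R x) \<le> c * q x" if "c > 0" for c x
    using assms that by (auto simp: sublinear_def)
  show "q (c *\<^sub>R x) = c * q x" if "c > 0"
  proof (rule antisym[OF le[OF that]])
    have "q ((1 / c) *\<^sub>R (c *\<^sub>R x)) \<le> (1 / c) * q (c *\<^sub>R x)"
      using that by (intro le) auto
    then show "c * q x \<le> q (c *\<^sub>R x)"
      using that by (simp add: field_simps)
  qed
  show zero: "q 0 = 0"
    using le[of 2 0] le[of "1/2" 0] by simp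
  show "- q (- x) \<le> q x"
    using add[of x "- x"] zero by simp
qed

lemma sublinear_norm: "sublinear norm"
  by (simp add: sublinear_def norm_triangle_ineq)

text \<open>A minimal sublinear \<open>q\<close> must coincide with this \<open>r\<close>, which forces it to be additive.\<close>

lemma sublinear_shift:
  fixes q :: "'a::real_vector \<Rightarrow> real"
  assumes q: "sublinear q"
  obtains r where "sublinear r" and "r \<le> q" and "\<And>x t. t \<ge> 0 \<Longrightarrow> r x \<le> q (x + t *\<^sub>R v) - t * q v"
proof -
  define r where "r x = (INF t\<in>{0..}. q (x + t *\<^sub>R v) - t * q v)" for x
  have scale: "q (t *\<^sub>R v) = t * q v" if "t \<ge> 0" for t
    using sublinearD(2,3)[OF q] that by (cases "t = 0") auto
  \<comment> \<open>This bound does not depend on \<open>t\<close>, so the infimum defining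
    \<open>r\<close> is a real number.\<close>
  have lower: "- q (- x) \<le> q (x + t *\<^sub>R v) - t * q v" if "t \<ge> 0" for x t
    using sublinearD(1)[OF q, of "x + t *\<^sub>R v" "- x"] scale[OF that] by simp
  have bdd: "bdd_below ((\<lambda>t. q (x + t *\<^sub>R v) - t * q v) ` {0..})" for x
    using lower by (intro bdd_belowI2) auto
  have r_le: "r x \<le> q (x + t *\<^sub>R v) - t * q v" if "t \<ge> 0" for x t
    unfolding r_def using that by (intro cINF_lower[OF bdd]) auto
  have r_ge: "z \<le> r x" if "\<And>t. t \<ge> 0 \<Longrightarrow> z \<le> q (x + t *\<^sub>R v) - t * q v" for x z
    unfolding r_def using that by (intro cINF_greatest) auto
  have "r (x + y) \<le> r x + r y" for x y
  proof -
    \<comment> \<open>Subadditivity of a double infimum: the parameters \<open>s\<close> for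
      \<open>x\<close> and \<open>t\<close> for \<open>y\<close> are matched by \<open>s + t\<close>
      for \<open>x + y\<close>; first \<open>s\<close>, then \<open>t\<close> is passed to the
      infimum.\<close>
    have "r (x + y) - (q (y + t *\<^sub>R v) - t * q v) \<le> r x" if t: "t \<ge> 0" for t
    proof (rule r_ge)
      fix s :: real assume s: "s \<ge> 0"
      have "r (x + y) \<le> q ((x + y) + (s + t) *\<^sub>R v) - (s + t) * q v"
        using s t by (intro r_le) auto
      also have "(x + y) + (s + t) *\<^sub>R v = (x + s *\<^sub>R v) + (y + t *\<^sub>R v)"
        by (simp add: algebra_simps)
      finally show "r (x + y) - (q (y + t *\<^sub>R v) - t * q v) \<le> q (x + s *\<^sub>R v) - s * q v"
        using sublinearD(1)[OF q, of "x + s *\<^sub>R v" "y + t *\<^sub>R v"] by (simp add: algebra_simps)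
    qed
    then have "r (x + y) - r x \<le> r y"
      by (intro r_ge) (simp add: algebra_simps)
    then show ?thesis by simp
  qed
  moreover have "r (c *\<^sub>R x) \<le> c * r x" if c: "c > 0" for c x
  proof -
    have "r (c *\<^sub>R x) / c \<le> r x"
    proof (rule r_ge)
      fix t :: real assume t: "t \<ge> 0"
      have "r (c *\<^sub>R x) \<le> q (c *\<^sub>R x + (c * t) *\<^sub>R v) - (c * t) * q v"
        using c t by (intro r_le) auto
      also have "c *\<^sub>R x + (c * t) *\<^sub>R v = c *\<^sub>R (x + t *\<^sub>R v)"
        by (simp add: algebra_simps)
      also have "q (c *\<^sub>R (x + t *\<^sub>R v)) = c * q (x + t *\<^sub>R v)"
        by (rule sublinearD(2)[OF q c])
      finally show "r (c *\<^sub>R x) / c \<le> q (x + t *\<^sub>R v) - t * q v"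
        using c by (simp add: field_simps)
    qed
    then show ?thesis using c by (simp add: field_simps)
  qed
  ultimately have "sublinear r"
    by (simp add: sublinear_def)
  moreover have "r \<le> q"
    using r_le[of 0] by (auto simp: le_fun_def)
  ultimately show thesis
    using that r_le by blast
qed

text \<open>Zorn's lemma for the reversed pointwise order. A nonempty chain has its pointwise
  infimum as a bound, which is finite because every sublinear \<open>q \<le> p\<close> satisfies
  \<open>- p (- x) \<le> q x\<close>.\<close>

lemma sublinear_minimal:
  fixes p :: "'a::real_vector \<Rightarrow> real"
  assumes p: "sublinear p"
  obtains q where "sublinear q" and "q \<le> p" and "\<And>r. sublinear r \<Longrightarrow> r \<le> q \<Longrightarrow> r = q"
proof -
  define S where "S = {q. sublinear q \<and> q \<le> p}"
  have "\<exists>m\<in>S. \<forall>q\<in>S. q \<le> m \<longrightarrow> q = m"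
  proof (rule predicate_Zorn)
    show "partial_order_on S (relation_of (\<lambda>x y. y \<le> x) S)"
      by (rule partial_order_on_relation_ofI) auto
  next
    fix C assume C: "C \<in> Chains (relation_of (\<lambda>x y. y \<le> x) S)"
    then have chain: "q \<le> r \<or> r \<le> q" and CS: "q \<in> S" if "q \<in> C" "r \<in> C" for q r
      using that by (auto simp: Chains_def relation_of_def)
    show "\<exists>u\<in>S. \<forall>q\<in>C. u \<le> q"
    proof (cases "C = {}")
      case True
      then show ?thesis using p by (auto simp: S_def)
    next
      case False
      then obtain q0 where q0: "q0 \<in> C" by blast
      define u where "u x = (INF q\<in>C. q x)" for x
      have bdd: "bdd_below ((\<lambda>q. q x) ` C)" for x
      proof (rule bdd_belowI2)
        fix q assume "q \<in> C"
        then have "sublinear q" "q (- x) \<le> p (- x)"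
          using CS by (auto simp: S_def le_fun_def)
        then show "- p (- x) \<le> q x"
          using sublinearD(4)[of q x] by simp
      qed
      have u_le: "u x \<le> q x" if "q \<in> C" for q x
        unfolding u_def using that by (intro cINF_lower[OF bdd])
      have u_ge: "z \<le> u x" if "\<And>q. q \<in> C \<Longrightarrow> z \<le> q x" for x z
        unfolding u_def using that False by (intro cINF_greatest) auto
      have "u (x + y) \<le> u x + u y" for x y
      proof -
        have "u (x + y) \<le> q x + r y" if qr: "q \<in> C" "r \<in> C" for q r
        proof -
          \<comment> \<open>The smaller of \<open>q\<close> and \<open>r\<close> serves both
            arguments at once; this is where the chain condition enters.\<close>
          obtain w where w: "w \<in> C" "w \<le> q" "w \<le> r"
            using chain[OF qr] qr by (metis order_refl)
          then have "u (x + y) \<le> w x + w y"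
            using u_le[OF w(1), of "x + y"] sublinearD(1)[of w x y] CS by (force simp: S_def)
          then show ?thesis
            using w(2,3) by (meson add_mono le_funD order_trans)
        qed
        then have "u (x + y) - r y \<le> u x" if "r \<in> C" for r
          using that by (intro u_ge) (simp add: algebra_simps)
        then have "u (x + y) - u x \<le> u y"
          by (intro u_ge) (simp add: algebra_simps)
        then show ?thesis by simp
      qed
      moreover have "u (c *\<^sub>R x) \<le> c * u x" if c: "c > 0" for c x
      proof -
        have "u (c *\<^sub>R x) / c \<le> u x"
        proof (rule u_ge)
          fix q assume q: "q \<in> C"
          then have "q (c *\<^sub>R x) = c * q x"
            using CS c by (intro sublinearD) (auto simp: S_def)
          then show "u (c *\<^sub>R x) / c \<le> q x"
            using u_le[OF q, of "c *\<^sub>R x"] c by (simp add: field_simps)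
        qed
        then show ?thesis using c by (simp add: field_simps)
      qed
      ultimately have "sublinear u"
        by (simp add: sublinear_def)
      moreover have "u \<le> p"
        using u_le[OF q0] CS[OF q0 q0] by (auto simp: S_def le_fun_def intro: order_trans)
      ultimately show ?thesis
        using u_le by (auto simp: S_def le_fun_def)
    qed
  qed
  then obtain m where m: "sublinear m" "m \<le> p" and min: "\<And>q. q \<in> S \<Longrightarrow> q \<le> m \<Longrightarrow> q = m"
    by (auto simp: S_def)
  have "r = m" if "sublinear r" "r \<le> m" for r
    using min[of r] that order_trans[OF that(2) m(2)] by (simp add: S_def)
  then show thesis
    by (rule that[OF m])
qed

text \<open>The functional shifted along \<open>y\<close> lies below \<open>q\<close>, so it equals
  \<open>q\<close>; its bound at \<open>t = 1\<close> is the missing superadditivity. Additivity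
  makes \<open>q\<close> odd, which covers negative scalars.\<close>

lemma linear_of_sublinear_minimal:
  fixes q :: "'a::real_vector \<Rightarrow> real"
  assumes q: "sublinear q" and min: "\<And>r. sublinear r \<Longrightarrow> r \<le> q \<Longrightarrow> r = q"
  shows "linear q"
proof -
  have add: "q (x + y) = q x + q y" for x y
  proof (rule antisym[OF sublinearD(1)[OF q]])
    obtain r where r: "sublinear r" "r \<le> q" "\<And>x t. t \<ge> 0 \<Longrightarrow> r x \<le> q (x + t *\<^sub>R y) - t * q y"
      using sublinear_shift[OF q] by blast
    with min[of r] show "q x + q y \<le> q (x + y)"
      using r(3)[of 1 x] by simp
  qed
  have neg: "q (- x) = - q x" for x
    using add[of x "- x"] sublinearD(3)[OF q] by simp
  have "q (c *\<^sub>R x) = c * q x" for c x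
  proof -
    consider "c > 0" | "c = 0" | "c < 0" by linarith
    then show ?thesis
    proof cases
      case 3
      then have "q ((- c) *\<^sub>R x) = (- c) * q x"
        by (intro sublinearD(2)[OF q]) auto
      then show ?thesis using neg[of "c *\<^sub>R x"] by simp
    qed (use sublinearD[OF q] in auto)
  qed
  with add show ?thesis
    by (intro linearI) auto
qed

text \<open>Instead of extending a functional from the line through \<open>v\<close>, the norm is
  first shifted along \<open>v\<close> and then lowered to a minimal sublinear functional, which is
  linear.\<close>

lemma norming_functional:
  fixes v :: "'a::real_normed_vector"
  obtains \<phi> :: "'a \<Rightarrow> real" where "bounded_linear \<phi>" and "\<And>x. \<bar>\<phi> x\<bar> \<le> norm x" and "\<phi> v = norm v"
proof -
  obtain r :: "'a \<Rightarrow> real" where r: "sublinear r" "r \<le> norm"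
      "\<And>x t. t \<ge> 0 \<Longrightarrow> r x \<le> norm (x + t *\<^sub>R v) - t * norm v"
    using sublinear_shift[OF sublinear_norm] by blast
  obtain \<phi> where \<phi>: "sublinear \<phi>" "\<phi> \<le> r" "\<And>s. sublinear s \<Longrightarrow> s \<le> \<phi> \<Longrightarrow> s = \<phi>"
    using sublinear_minimal[OF r(1)] by blast
  have lin: "linear \<phi>"
    by (rule linear_of_sublinear_minimal[OF \<phi>(1,3)])
  have le: "\<phi> x \<le> norm x" for x
    using \<phi>(2) r(2) by (meson le_funD order_trans)
  have abs: "\<bar>\<phi> x\<bar> \<le> norm x" for x
    using le[of x] le[of "- x"] linear_neg[OF lin, of x] by simp
  \<comment> \<open>At \<open>- v\<close> with \<open>t = 1\<close> the shift bound is
    \<open>- norm v\<close>, so oddness gives \<open>norm v \<le> \<phi> v\<close>.\<close>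
  have "\<phi> (- v) \<le> norm (- v + 1 *\<^sub>R v) - 1 * norm v"
    using le_funD[OF \<phi>(2), of "- v"] r(3)[of 1 "- v"] by simp
  then have "\<phi> v = norm v"
    using le[of v] linear_neg[OF lin, of v] by simp
  moreover have "bounded_linear \<phi>"
  proof (rule bounded_linear_intro[where K = 1])
    show "norm (\<phi> x) \<le> norm x * 1" for x using abs[of x] by simp
  qed (simp_all add: linear_add[OF lin] linear_scale[OF lin])
  ultimately show thesis
    using abs by (intro that)
qed

section \<open>Hermite interpolation\<close>

text \<open>One zero of \<open>f'\<close> is found in each gap between neighbouring points, by
  adding the points in increasing order. That \<open>T\<close> avoids \<open>S\<close> matters for
  Hermite interpolation, where the nodes are zeros of the derivative as well and must not be counted
  twice.\<close>

lemma Rolle_zeros: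
  fixes f f' :: "real \<Rightarrow> real"
  assumes "finite S" and "S \<noteq> {}" and "S \<subseteq> {a..b}"
    and "\<And>x. x \<in> S \<Longrightarrow> f x = 0"
    and der: "\<And>x. x \<in> {a..b} \<Longrightarrow> (f has_vector_derivative f' x) (at x within {a..b})"
  shows "\<exists>T. finite T \<and> Suc (card T) = card S \<and> T \<subseteq> {Min S<..<Max S} - S \<and> (\<forall>x\<in>T. f' x = 0)"
  using assms(1-4)
proof (induction S rule: finite_linorder_max_induct)
  case empty
  then show ?case by simp
next
  case (insert c S)
  show ?case
  proof (cases "S = {}")
    case True
    then show ?thesis by (intro exI[of _ "{}"]) auto
  next
    case False
    define d where "d = Max S"
    have d: "d \<in> S" and d_max: "\<And>x. x \<in> S \<Longrightarrow> x \<le> d"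
      using insert.hyps False by (auto simp: d_def)
    have "d < c" using insert.hyps d by blast
    have sub: "{d..c} \<subseteq> {a..b}" using d insert.prems by auto
    obtain T where T: "finite T" "Suc (card T) = card S" "T \<subseteq> {Min S<..<d} - S" "\<forall>x\<in>T. f' x = 0"
      using insert False by (auto simp: d_def)
    have "\<exists>z. d < z \<and> z < c \<and> (\<lambda>h. h * f' z) = (\<lambda>h. 0)"
    proof (rule Rolle_deriv[OF \<open>d < c\<close>])
      show "f d = f c" using insert.prems d by simp
      show "continuous_on {d..c} f"
        using der sub by (meson continuous_on_subset continuous_on_vector_derivative)
      fix x assume x: "d < x" "x < c"
      then have "x \<in> interior {a..b}" using sub by auto
      then show "(f has_derivative (\<lambda>h. h * f' x)) (at x)"
        using der[of x] x sub at_within_interior[of x "{a..b}"]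
        by (auto simp: has_vector_derivative_def interior_subset)
    qed
    then obtain z where z: "d < z" "z < c" "f' z = 0"
      by (metis mult_1)
    have Min: "Min (insert c S) = Min S"
    proof -
      have "Min S \<le> d" using insert.hyps d by simp
      then show ?thesis using insert.hyps False \<open>d < c\<close> by (simp add: min_absorb2)
    qed
    have Max: "Max (insert c S) = c"
      using insert.hyps False \<open>d < c\<close> by (simp add: d_def max_absorb1)
    have "Min S \<le> d" using insert.hyps d by simp
    have "z \<notin> T" "c \<notin> S" "z \<notin> S" using T z d_max \<open>d < c\<close> by force+
    moreover have "insert z T \<subseteq> {Min S<..<c} - insert c S"
      using T(3) z \<open>Min S \<le> d\<close> \<open>z \<notin> S\<close> by auto
    ultimately show ?thesis
      unfolding Min Max using T z insert.hyps
      by (intro exI[of _ "insert z T"]) auto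
  qed
qed

text \<open>Each application of Rolle's theorem costs one zero. The starting index \<open>k\<close>
  lets the induction climb through the derivatives; the Hermite remainder uses it with
  \<open>k = 1\<close>.\<close>

lemma Rolle_higher:
  fixes g :: "nat \<Rightarrow> real \<Rightarrow> real"
  assumes "finite S" and "n < card S" and "S \<subseteq> {a..b}" and "\<And>x. x \<in> S \<Longrightarrow> g k x = 0"
    and "\<And>i x. i < k + n \<Longrightarrow> x \<in> {a..b} \<Longrightarrow> (g i has_vector_derivative g (Suc i) x) (at x within {a..b})"
  shows "\<exists>x\<in>{a..b}. g (k + n) x = 0"
  using assms
proof (induction n arbitrary: k S)
  case 0
  then obtain x where "x \<in> S" by fastforce
  then show ?case using 0 by auto
next
  case (Suc n)
  have "S \<noteq> {}" using Suc.prems by auto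
  obtain T where T: "finite T" "Suc (card T) = card S" "T \<subseteq> {Min S<..<Max S} - S" "\<forall>x\<in>T. g (Suc k) x = 0"
    using Rolle_zeros[of S a b "g k" "g (Suc k)", OF Suc.prems(1) \<open>S \<noteq> {}\<close> Suc.prems(3,4)]
      Suc.prems(5)[of k] by auto
  have "Min S \<in> {a..b}" "Max S \<in> {a..b}"
    using Suc.prems(1,3) \<open>S \<noteq> {}\<close> Min_in Max_in by blast+
  then have "T \<subseteq> {a..b}" using T(3) by auto
  then have "\<exists>x\<in>{a..b}. g (Suc k + n) x = 0"
    using T Suc.prems by (intro Suc.IH[of T]) auto
  then show ?case by simp
qed

section \<open>Existence and remainder of the Hermite interpolant\<close>

lemma degree_prod_linear [simp]:
  "degree (\<Prod>y\<in>Z. [:- y, 1:]) = card Z" for Z :: "'a::idom set"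
  by (subst degree_prod_sum_eq) auto

lemma lead_coeff_prod_linear:
  "coeff (\<Prod>y\<in>Z. [:- y, 1:]) (card Z) = 1" for Z :: "'a::idom set"
  using lead_coeff_prod[of "\<lambda>y. [:- y, 1:]" Z] by simp

lemma prod_linear_nonzero [simp]: "(\<Prod>y\<in>Z. [:- y, 1:]) \<noteq> 0" for Z :: "'a::idom set"
  using lead_coeff_prod_linear[of Z] by (metis coeff_0 zero_neq_one)

text \<open>Newton-style induction on the nodes: the square \<open>W\<close> of the node polynomial
  vanishes doubly at the old nodes, so adding \<open>W\<close> times a linear factor leaves the old
  data intact and has two free coefficients for the new node.\<close>

lemma Hermite_interpolant:
  fixes u v :: "real \<Rightarrow> real"
  assumes "finite Z"
  shows "\<exists>H. degree H \<le> 2 * card Z - 1 \<and> (\<forall>z\<in>Z. poly H z = u z \<and> poly (pderiv H) z = v z)"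
  using assms
proof (induction Z)
  case empty
  show ?case by (intro exI[of _ 0]) auto
next
  case (insert z Z)
  then obtain H where H: "degree H \<le> 2 * card Z - 1"
      "\<And>y. y \<in> Z \<Longrightarrow> poly H y = u y" "\<And>y. y \<in> Z \<Longrightarrow> poly (pderiv H) y = v y"
    by blast
  define Q where "Q = (\<Prod>y\<in>Z. [:- y, 1:])"
  define W where "W = Q * Q"
  have Wz: "poly W z \<noteq> 0" and WZ: "\<And>y. y \<in> Z \<Longrightarrow> poly W y = 0 \<and> poly (pderiv W) y = 0"
    using insert.hyps by (auto simp: W_def Q_def poly_prod pderiv_mult)
  \<comment> \<open>The linear factor in \<open>G\<close> is \<alpha> + \<beta> (x - z), with value
    \<alpha> and slope \<beta> at \<open>z\<close>; the two conditions at \<open>z\<close> form a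
    triangular system for \<alpha> and \<beta>.\<close>
  define \<alpha> where "\<alpha> = (u z - poly H z) / poly W z"
  define \<beta> where "\<beta> = (v z - poly (pderiv H) z - poly (pderiv W) z * \<alpha>) / poly W z"
  define G where "G = H + W * [:\<alpha> - \<beta> * z, \<beta>:]"
  have "degree W = 2 * card Z"
    by (simp add: W_def Q_def degree_mult_eq)
  then have "degree (W * [:\<alpha> - \<beta> * z, \<beta>:]) \<le> 2 * card Z + 1"
    using degree_mult_le[of W "[:\<alpha> - \<beta> * z, \<beta>:]"] by (simp split: if_splits)
  then have "degree G \<le> 2 * card (insert z Z) - 1"
    unfolding G_def using H(1) insert.hyps by (intro degree_add_le) auto
  moreover have "poly G y = u y \<and> poly (pderiv G) y = v y" if "y \<in> insert z Z" for y
  proof (cases "y = z")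
    case True
    have "poly W z * \<alpha> = u z - poly H z"
      "poly W z * \<beta> = v z - poly (pderiv H) z - poly (pderiv W) z * \<alpha>"
      using Wz by (simp_all add: \<alpha>_def \<beta>_def)
    then show ?thesis
      using True unfolding G_def pderiv_add pderiv_mult
      by (simp add: pderiv_pCons algebra_simps del: mult_pCons_right)
  next
    case False
    then show ?thesis
      using that H(2,3)[of y] WZ[of y] unfolding G_def pderiv_add pderiv_mult
      by (simp add: pderiv_pCons del: mult_pCons_right)
  qed
  ultimately show ?case by blast
qed

text \<open>A multiple of the squared node polynomial is added to \<open>H\<close> so that the
  difference to the function also vanishes at \<open>x\<close>. Counting zeros by Rolle then gives a
  point where its derivative of order \<open>2 * card Z\<close> vanishes, which evaluates the
  multiple.\<close>

lemma Hermite_error: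
  fixes fd :: "nat \<Rightarrow> real \<Rightarrow> real"
  assumes Z: "finite Z" "Z \<subseteq> {a..b}" and "Z \<noteq> {}"
    and der: "\<And>i x. i < 2 * card Z \<Longrightarrow> x \<in> {a..b} \<Longrightarrow>
           (fd i has_vector_derivative fd (Suc i) x) (at x within {a..b})"
    and bound: "\<And>x. x \<in> {a..b} \<Longrightarrow> \<bar>fd (2 * card Z) x\<bar> \<le> B"
    and H: "degree H < 2 * card Z" "\<And>z. z \<in> Z \<Longrightarrow> poly H z = fd 0 z"
      "\<And>z. z \<in> Z \<Longrightarrow> poly (pderiv H) z = fd 1 z"
    and x: "x \<in> {a..b}"
  shows "\<bar>fd 0 x - poly H x\<bar> \<le> B / fact (2 * card Z) * (\<Prod>z\<in>Z. x - z)\<^sup>2"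
proof (cases "x \<in> Z")
  case True
  then have "(\<Prod>z\<in>Z. x - z) = 0" using Z by auto
  then show ?thesis using True H by simp
next
  case False
  define M where "M = card Z"
  have "M > 0" using Z \<open>Z \<noteq> {}\<close> by (auto simp: M_def card_gt_0_iff)
  define Q where "Q = (\<Prod>y\<in>Z. [:- y, 1:])"
  define W where "W = Q * Q"
  have W_x: "poly W x = (\<Prod>z\<in>Z. x - z)\<^sup>2"
    by (simp add: W_def Q_def poly_prod power2_eq_square)
  have Wx: "poly W x > 0" using False Z by (simp add: W_x)
  have WZ: "\<And>y. y \<in> Z \<Longrightarrow> poly W y = 0 \<and> poly (pderiv W) y = 0"
    using Z by (auto simp: W_def Q_def poly_prod pderiv_mult)
  have degW: "degree W = 2 * M"
    by (simp add: W_def Q_def degree_mult_eq M_def)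
  have "lead_coeff W = 1"
    by (simp only: W_def Q_def lead_coeff_mult lead_coeff_prod) simp
  define c where "c = (fd 0 x - poly H x) / poly W x"
  define R where "R = H + smult c W"
  define g where "g i t = fd i t - poly ((pderiv ^^ i) R) t" for i t
  have g_der: "(g i has_vector_derivative g (Suc i) t) (at t within {a..b})"
    if "i < 2 * M" "t \<in> {a..b}" for i t
    unfolding g_def funpow.simps o_def
    by (rule has_vector_derivative_diff[OF der[OF that[unfolded M_def]] has_vector_derivative_at_within]
        has_real_derivative_iff_has_vector_derivative[THEN iffD1] poly_DERIV)+
  have g0: "g 0 t = 0" if "t \<in> insert x Z" for t
    using that H(2) WZ Wx by (auto simp: g_def R_def c_def)
  have g1: "g 1 t = 0" if "t \<in> Z" for t
    using that H(3) WZ by (simp add: g_def R_def pderiv_add pderiv_smult)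
  obtain T where T: "finite T" "Suc (card T) = card (insert x Z)"
      "T \<subseteq> {Min (insert x Z)<..<Max (insert x Z)} - insert x Z" "\<forall>t\<in>T. g 1 t = 0"
  proof -
    have "(g 0 has_vector_derivative g 1 t) (at t within {a..b})" if "t \<in> {a..b}" for t
      using g_der[of 0 t] that \<open>M > 0\<close> by simp
    then show thesis
      using Rolle_zeros[of "insert x Z" a b "g 0" "g 1"] g0 Z x that by blast
  qed
  have sub: "insert x Z \<subseteq> {a..b}" using Z(2) x by auto
  have "Min (insert x Z) \<in> {a..b}"
    by (rule subsetD[OF sub Min_in]) (use Z in auto)
  moreover have "Max (insert x Z) \<in> {a..b}"
    by (rule subsetD[OF sub Max_in]) (use Z in auto)
  ultimately have T_sub: "Z \<union> T \<subseteq> {a..b}" using T(3) Z(2) by auto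
  \<comment> \<open>The first derivative of \<open>g\<close> vanishes at the \<open>M\<close> nodes
    and at \<open>M\<close> further points between the \<open>M + 1\<close> zeros of
    \<open>g\<close>.\<close>
  have "card (Z \<union> T) = 2 * M"
    using T Z False by (subst card_Un_disjoint) (auto simp: M_def)
  then have "\<exists>t\<in>{a..b}. g (1 + (2 * M - 1)) t = 0"
    using T Z T_sub g1 \<open>M > 0\<close> g_der by (intro Rolle_higher[of "Z \<union> T"]) auto
  then obtain t where t: "t \<in> {a..b}" "g (2 * M) t = 0"
    using \<open>M > 0\<close> by auto
  \<comment> \<open>Differentiating \<open>2 * M\<close> times kills \<open>H\<close> and reduces
    the monic \<open>W\<close> to a constant, so \<open>t\<close> determines
    \<open>c\<close>.\<close>
  have "(pderiv ^^ (2 * M)) H = 0"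
    using H(1) by (intro poly_eqI) (simp add: coeff_higher_pderiv coeff_eq_0 M_def)
  moreover have "(pderiv ^^ (2 * M)) W = [:fact (2 * M):]"
    using \<open>lead_coeff W = 1\<close> degW
    by (intro poly_eqI) (auto simp: coeff_higher_pderiv coeff_eq_0 coeff_pCons pochhammer_fact split: nat.splits)
  ultimately have "fd (2 * M) t = c * fact (2 * M)"
    using t(2) by (simp add: g_def R_def higher_pderiv_add higher_pderiv_smult)
  then have "\<bar>c\<bar> \<le> B / fact (2 * M)"
    using bound[OF t(1)] by (simp add: M_def[symmetric] abs_mult field_simps)
  then have "\<bar>c\<bar> * poly W x \<le> B / fact (2 * M) * poly W x"
    using Wx by (intro mult_right_mono) auto
  moreover have "\<bar>c\<bar> * poly W x = \<bar>fd 0 x - poly H x\<bar>"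
    using Wx by (simp add: c_def abs_divide)
  ultimately show ?thesis
    by (simp add: W_x M_def)
qed

section \<open>Discrete Chebyshev polynomials\<close>

definition poly_diff :: "real poly \<Rightarrow> real poly" where
  "poly_diff p = pcompose p [:1, 1:] - p"

lemma poly_poly_diff: "poly (poly_diff p) x = poly p (x + 1) - poly p x"
  by (simp add: poly_diff_def poly_pcompose add.commute)

lemma poly_diff_pCons: "poly_diff (pCons a p) = [:1, 1:] * poly_diff p + p"
  by (simp add: poly_diff_def pcompose_pCons algebra_simps)

lemma poly_diff_eq_0: "degree p = 0 \<Longrightarrow> poly_diff p = 0"
  by (auto elim!: degree_eq_zeroE simp: poly_diff_def)

text \<open>To leading order the forward difference acts like the derivative. The product rule for
  multiplication by the variable, \<open>poly_diff_pCons\<close>, drives the induction; a degree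
  bound in place of an exact degree allows iteration.\<close>

lemma poly_diff_degree_coeff:
  "degree p \<le> Suc k \<Longrightarrow> degree (poly_diff p) \<le> k \<and> coeff (poly_diff p) k = real (Suc k) * coeff p (Suc k)"
proof (induction p arbitrary: k)
  case 0
  then show ?case by (simp add: poly_diff_eq_0)
next
  case (pCons a p)
  show ?case
  proof (cases "degree p = 0")
    case True
    then show ?thesis
      by (auto elim!: degree_eq_zeroE simp: poly_diff_def pcompose_pCons coeff_pCons split: nat.splits)
  next
    case False
    with pCons.prems obtain j where j: "k = Suc j" "degree p \<le> Suc j"
      by (cases k) (auto split: if_splits)
    with pCons.IH have IH: "degree (poly_diff p) \<le> j"
      "coeff (poly_diff p) j = real (Suc j) * coeff p (Suc j)" by auto
    have "degree ([:1, 1:] * poly_diff p) \<le> k"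
      using degree_mult_le[of "[:1, 1:]" "poly_diff p"] IH j by simp
    then have "degree (poly_diff (pCons a p)) \<le> k"
      unfolding poly_diff_pCons using j by (intro degree_add_le) auto
    moreover have "coeff (poly_diff p) k = 0"
      using IH j by (intro coeff_eq_0) auto
    ultimately show ?thesis
      using IH j by (simp add: poly_diff_pCons algebra_simps)
  qed
qed

lemma poly_diff_iterate:
  assumes "degree p \<le> n + k"
  shows "degree ((poly_diff ^^ n) p) \<le> k \<and>
    coeff ((poly_diff ^^ n) p) k * fact k = fact (n + k) * coeff p (n + k)"
  using assms
proof (induction n arbitrary: k)
  case 0
  then show ?case by simp
next
  case (Suc n)
  then have IH: "degree ((poly_diff ^^ n) p) \<le> Suc k"
    "coeff ((poly_diff ^^ n) p) (Suc k) * fact (Suc k) = fact (n + Suc k) * coeff p (n + Suc k)"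
    using Suc.IH[of "Suc k"] by auto
  with poly_diff_degree_coeff[OF IH(1)] show ?case by (simp add: algebra_simps)
qed

lemma poly_diff_iterate_eq_0:
  assumes "degree p < n"
  shows "(poly_diff ^^ n) p = 0"
proof -
  obtain k where k: "n = Suc k" using assms by (cases n) auto
  then have "degree ((poly_diff ^^ k) p) = 0"
    using poly_diff_iterate[of p k 0] assms by auto
  then show ?thesis
    using k by (simp add: poly_diff_eq_0)
qed

text \<open>The \<open>n\<close>-th difference at \<open>x\<close> involves only the values at
  \<open>x, ..., x + n\<close>. This removes the boundary terms in the summation by parts.\<close>

lemma poly_diff_iterate_zero:
  assumes "\<And>i. i \<le> n \<Longrightarrow> poly u (x + real i) = 0"
  shows "poly ((poly_diff ^^ n) u) x = 0"
  using assms
proof (induction n arbitrary: x)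
  case 0
  then show ?case using 0[of 0] by simp
next
  case (Suc n)
  have "poly ((poly_diff ^^ n) u) x = 0"
    using Suc.prems by (intro Suc.IH) auto
  moreover have "poly ((poly_diff ^^ n) u) (x + 1) = 0"
  proof (rule Suc.IH)
    fix i assume "i \<le> n"
    then show "poly u (x + 1 + real i) = 0"
      using Suc.prems[of "Suc i"] by (simp add: algebra_simps)
  qed
  ultimately show ?case by (simp add: poly_poly_diff)
qed

lemma poly_diff_pcompose_shift:
  "(poly_diff ^^ n) (pcompose u [:1, 1:]) = pcompose ((poly_diff ^^ n) u) [:1, 1:]"
  by (induction n) (simp_all add: poly_diff_def pcompose_diff)

text \<open>Each step moves one difference from \<open>u\<close> to \<open>h\<close> at the price of
  a sign and a unit shift of \<open>u\<close>; the prescribed zeros of \<open>u\<close> near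
  \<open>0\<close> and \<open>N\<close> make all boundary terms vanish.\<close>

lemma sum_by_parts_iterate:
  assumes "\<And>i. i < n \<Longrightarrow> poly u (real i) = 0" and "\<And>i. i < n \<Longrightarrow> poly u (real (N + i)) = 0"
  shows "(\<Sum>x<N. poly ((poly_diff ^^ n) u) (real x) * poly h (real x)) =
    (-1) ^ n * (\<Sum>x<N. poly u (real (x + n)) * poly ((poly_diff ^^ n) h) (real x))"
  using assms
proof (induction n arbitrary: u h)
  case 0
  then show ?case by simp
next
  case (Suc n)
  define v where "v = (poly_diff ^^ n) u"
  \<comment> \<open>The shift is absorbed into a new polynomial, to which the induction hypothesis
    applies because its zeros come from those of \<open>u\<close> at \<open>Suc i\<close>.\<close>
  define w where "w = pcompose u [:1, 1:]"
  have v0: "poly v 0 = 0"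
    unfolding v_def using Suc.prems(1) by (intro poly_diff_iterate_zero) simp
  have vN: "poly v (real N) = 0"
    unfolding v_def
  proof (rule poly_diff_iterate_zero)
    fix i assume "i \<le> n"
    then show "poly u (real N + real i) = 0" using Suc.prems(2)[of i] by simp
  qed
  \<comment> \<open>The telescoping summand is split by the discrete product rule, whose second term
    carries \<open>v\<close> at \<open>x + 1\<close>.\<close>
  have "(\<Sum>x<N. poly v (real (Suc x)) * poly h (real (Suc x)) - poly v (real x) * poly h (real x)) = 0"
    by (subst sum_lessThan_telescope) (simp add: v0 vN)
  then have "(\<Sum>x<N. poly (poly_diff v) (real x) * poly h (real x)
      + poly v (real x + 1) * poly (poly_diff h) (real x)) = 0"
    by (simp add: poly_poly_diff algebra_simps)
  then have "(\<Sum>x<N. poly (poly_diff v) (real x) * poly h (real x)) =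
      - (\<Sum>x<N. poly v (real x + 1) * poly (poly_diff h) (real x))"
    by (simp add: sum.distrib)
  also have "(\<Sum>x<N. poly v (real x + 1) * poly (poly_diff h) (real x)) =
      (\<Sum>x<N. poly ((poly_diff ^^ n) w) (real x) * poly (poly_diff h) (real x))"
    by (simp add: v_def w_def poly_diff_pcompose_shift poly_pcompose add.commute)
  also have "\<dots> = (-1) ^ n * (\<Sum>x<N. poly w (real (x + n)) * poly ((poly_diff ^^ n) (poly_diff h)) (real x))"
  proof (rule Suc.IH)
    fix i assume "i < n"
    then show "poly w (real i) = 0" "poly w (real (N + i)) = 0"
      using Suc.prems(1)[of "Suc i"] Suc.prems(2)[of "Suc i"]
      by (auto simp: w_def poly_pcompose algebra_simps)
  qed
  finally show ?case
    by (simp add: v_def w_def poly_pcompose funpow_swap1 algebra_simps)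
qed

text \<open>Combinatorially, subsets of size \<open>a + b + 1\<close> are sorted by their element
  number \<open>a + 1\<close>, at position \<open>x + a\<close> counted from zero. The proof is a
  double induction with Pascal's rule.\<close>

lemma sum_choose_mult_choose:
  "(\<Sum>x<N. ((x + a) choose a) * ((N - 1 - x) choose b)) = (N + a) choose (a + b + 1)"
proof (induction b arbitrary: N)
  case 0
  show ?case
  proof (cases N)
    case (Suc k)
    then show ?thesis
      using choose_rising_sum(1)[of a k] by (simp add: lessThan_Suc_atMost add.commute)
  qed simp
next
  case (Suc b)
  show ?case
  proof (induction N)
    case (Suc N)
    \<comment> \<open>The summand at \<open>x = N\<close> is zero, since it contains
      \<open>0 choose Suc b\<close>; for smaller \<open>x\<close> Pascal's rule becomes
      applicable.\<close>
    have "(\<Sum>x<Suc N. ((x + a) choose a) * ((Suc N - 1 - x) choose Suc b)) =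
        (\<Sum>x<N. ((x + a) choose a) * (Suc (N - 1 - x) choose Suc b))"
      by (simp add: Suc_diff_Suc)
    also have "\<dots> = (\<Sum>x<N. ((x + a) choose a) * ((N - 1 - x) choose b))
        + (\<Sum>x<N. ((x + a) choose a) * ((N - 1 - x) choose Suc b))"
      by (simp add: sum.distrib[symmetric] distrib_left)
    also have "\<dots> = Suc N + a choose (a + Suc b + 1)"
      using Suc.IH \<open>\<And>N. _ = N + a choose (a + b + 1)\<close>[of N] by simp
    finally show ?case .
  qed simp
qed

text \<open>A discrete counterpart of the power of \<open>x^2 - 1\<close> in the Rodrigues formula
  for Legendre polynomials; its zeros are those required by
  \<open>sum_by_parts_iterate\<close>.\<close>

definition dcheb_base :: "nat \<Rightarrow> nat \<Rightarrow> real poly" where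
  "dcheb_base N n = (\<Prod>i<n. [:- real i, 1:]) * (\<Prod>i<n. [:- real (N + i), 1:])"

text \<open>The discrete Chebyshev polynomials on \<open>{0, \<dots>, N - 1}\<close>, by their Rodrigues formula.\<close>

definition dcheb :: "nat \<Rightarrow> nat \<Rightarrow> real poly" where
  "dcheb N n = (poly_diff ^^ n) (dcheb_base N n)"

lemma degree_dcheb_base: "degree (dcheb_base N n) = 2 * n"
proof -
  have "(\<Prod>i<n. [:- real i, 1:]) \<noteq> 0" "(\<Prod>i<n. [:- real (N + i), 1:]) \<noteq> 0" by auto
  then show ?thesis
    unfolding dcheb_base_def by (subst degree_mult_eq) (auto simp: degree_prod_sum_eq)
qed

lemma lead_coeff_dcheb_base: "coeff (dcheb_base N n) (2 * n) = 1"
proof -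
  have "lead_coeff (dcheb_base N n) = 1"
    by (simp only: dcheb_base_def lead_coeff_mult lead_coeff_prod) simp
  then show ?thesis by (simp only: degree_dcheb_base)
qed

lemma coeff_dcheb: "coeff (dcheb N n) n = fact (2 * n) / fact n"
proof -
  have "coeff (dcheb N n) n * fact n = fact (2 * n)"
    using poly_diff_iterate[of "dcheb_base N n" n n]
    by (simp add: dcheb_def degree_dcheb_base lead_coeff_dcheb_base mult_2[symmetric])
  then show ?thesis by (simp add: eq_divide_eq)
qed

lemma degree_dcheb: "degree (dcheb N n) = n"
proof (rule antisym)
  show "degree (dcheb N n) \<le> n"
    using poly_diff_iterate[of "dcheb_base N n" n n] by (simp add: dcheb_def degree_dcheb_base)
  show "n \<le> degree (dcheb N n)"
    by (rule le_degree) (simp add: coeff_dcheb)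
qed

lemma dcheb_sum:
  "(\<Sum>x<N. poly (dcheb N n) (real x) * poly h (real x)) =
    (-1) ^ n * (\<Sum>x<N. poly (dcheb_base N n) (real (x + n)) * poly ((poly_diff ^^ n) h) (real x))"
  unfolding dcheb_def by (rule sum_by_parts_iterate) (auto simp: dcheb_base_def poly_prod)

lemma dcheb_orthogonal:
  assumes "degree h < n"
  shows "(\<Sum>x<N. poly (dcheb N n) (real x) * poly h (real x)) = 0"
  by (subst dcheb_sum) (simp add: poly_diff_iterate_eq_0[OF assms])

lemma prod_diff_eq_choose: "(\<Prod>i<n. real k - real i) = fact n * real (k choose n)"
  by (simp add: binomial_gbinomial gbinomial_mult_fact atLeast0LessThan)

text \<open>Both factors are falling factorials up to sign, which brings the sum for the norm into
  the form of \<open>sum_choose_mult_choose\<close>.\<close>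

lemma poly_dcheb_base_shift:
  assumes "x < N"
  shows "poly (dcheb_base N n) (real (x + n)) =
    (-1) ^ n * (fact n)\<^sup>2 * real (((x + n) choose n) * ((N - 1 - x) choose n))"
proof -
  \<comment> \<open>Reversing the order of the factors turns each into the negative of
    \<open>N - 1 - x - i\<close>.\<close>
  have "(\<Prod>i<n. real (x + n) - real (N + i)) = (\<Prod>i<n. real (x + n) - real (N + (n - Suc i)))"
    by (rule prod.nat_diff_reindex[where g = "\<lambda>i. real (x + n) - real (N + i)", symmetric])
  also have "\<dots> = (\<Prod>i<n. (-1) * (real (N - 1 - x) - real i))"
    using assms by (intro prod.cong) (auto simp: of_nat_diff)
  also have "\<dots> = (-1) ^ n * (\<Prod>i<n. real (N - 1 - x) - real i)"
    by (subst prod.distrib) simp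
  finally have "(\<Prod>i<n. real (x + n) - real (N + i)) = (-1) ^ n * (fact n * real ((N - 1 - x) choose n))"
    by (simp only: prod_diff_eq_choose)
  moreover have "poly (dcheb_base N n) (real (x + n)) =
      (\<Prod>i<n. real (x + n) - real i) * (\<Prod>i<n. real (x + n) - real (N + i))"
    unfolding dcheb_base_def poly_mult poly_prod by (intro arg_cong2[where f = "(*)"] prod.cong) auto
  ultimately show ?thesis
    by (simp only: prod_diff_eq_choose) (simp add: power2_eq_square)
qed

text \<open>Summation by parts of the polynomial against itself: its \<open>n\<close>-th difference
  is the constant \<open>fact (2 * n)\<close>, so only a binomial sum remains. The sign from the
  summation cancels the one in \<open>poly_dcheb_base_shift\<close>.\<close>

lemma dcheb_norm:
  "(\<Sum>x<N. (poly (dcheb N n) (real x))\<^sup>2) = fact (2 * n) * (fact n)\<^sup>2 * real ((N + n) choose (2 * n + 1))"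
proof -
  have deg: "degree ((poly_diff ^^ n) (dcheb N n)) = 0"
    using poly_diff_iterate[of "dcheb N n" n 0] by (simp add: degree_dcheb)
  then have "poly ((poly_diff ^^ n) (dcheb N n)) x = coeff ((poly_diff ^^ n) (dcheb N n)) 0" for x
    by (auto elim!: degree_eq_zeroE)
  then have const: "poly ((poly_diff ^^ n) (dcheb N n)) x = fact (2 * n)" for x
    using poly_diff_iterate[of "dcheb N n" n 0] by (simp add: degree_dcheb coeff_dcheb)
  have "(\<Sum>x<N. (poly (dcheb N n) (real x))\<^sup>2) =
      (-1) ^ n * (\<Sum>x<N. poly (dcheb_base N n) (real (x + n)) * fact (2 * n))"
    unfolding power2_eq_square by (simp only: dcheb_sum const)
  also have "(\<Sum>x<N. poly (dcheb_base N n) (real (x + n)) * fact (2 * n)) =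
      (\<Sum>x<N. ((-1) ^ n * (fact n)\<^sup>2 * fact (2 * n)) * real (((x + n) choose n) * ((N - 1 - x) choose n)))"
    by (intro sum.cong refl) (simp only: lessThan_iff poly_dcheb_base_shift mult_ac)
  also have "\<dots> = (-1) ^ n * (fact n)\<^sup>2 * fact (2 * n) * real ((N + n) choose (2 * n + 1))"
    using sum_choose_mult_choose[of n N n]
    by (simp only: sum_distrib_left[symmetric] of_nat_sum[symmetric]) (simp add: mult_2)
  finally show ?thesis
    by (simp add: power_add[symmetric] mult_2[symmetric] mult.assoc[symmetric])
qed

text \<open>The left-hand side is \<open>N\<close> times the product of the factors
  \<open>N^2 - i^2\<close> for \<open>i\<close> from \<open>1\<close> to \<open>n\<close>; the
  induction step multiplies it by \<open>(N + Suc n) * (N - Suc n)\<close>.\<close>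

lemma fact_mult_choose_le:
  "n < N \<Longrightarrow> fact (2 * n + 1) * ((N + n) choose (2 * n + 1)) \<le> N ^ (2 * n + 1)"
proof (induction n)
  case 0
  then show ?case by simp
next
  case (Suc n)
  define A where "A = fact (2 * n + 1) * ((N + n) choose (2 * n + 1))"
  have lt: "Suc n < N" and IH: "A \<le> N ^ (2 * n + 1)"
    using Suc by (auto simp: A_def)
  have eq: "fact k * (m choose k) * fact (m - k) = fact m" if "k \<le> m" for k m :: nat
    using binomial_fact_lemma[OF that] by (simp add: mult_ac)
  have e1: "A * fact (N - n - 1) = fact (N + n)"
    using eq[of "2 * n + 1" "N + n"] lt unfolding A_def by (simp add: diff_diff_add[symmetric])
  have e2: "fact (2 * Suc n + 1) * ((N + Suc n) choose (2 * Suc n + 1)) * fact (N - Suc n - 1) = fact (N + Suc n)"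
    using eq[of "2 * Suc n + 1" "N + Suc n"] lt by (simp add: diff_diff_add[symmetric])
  have e4: "fact (N + Suc n) = (N + Suc n) * fact (N + n)" by simp
  have e3: "fact (N - n - 1) = (N - Suc n) * fact (N - Suc n - 1)"
    using lt by (subst fact_reduce) auto
  have "fact (2 * Suc n + 1) * ((N + Suc n) choose (2 * Suc n + 1)) * fact (N - Suc n - 1)
     = (N + Suc n) * (N - Suc n) * A * fact (N - Suc n - 1)"
    unfolding e2 e4 e1[symmetric] e3 by (simp only: mult_ac)
  then have "fact (2 * Suc n + 1) * ((N + Suc n) choose (2 * Suc n + 1)) = (N + Suc n) * (N - Suc n) * A"
    by (metis fact_nonzero mult_right_cancel)
  also have "\<dots> \<le> N\<^sup>2 * A"
  proof (rule mult_right_mono)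
    have "(N + Suc n) * (N - Suc n) + (Suc n)\<^sup>2 = N\<^sup>2"
      using lt by (auto simp: nat_le_iff_add less_iff_Suc_add power2_eq_square algebra_simps)
    then show "(N + Suc n) * (N - Suc n) \<le> N\<^sup>2" by linarith
  qed simp
  also have "\<dots> \<le> N\<^sup>2 * N ^ (2 * n + 1)"
    using IH by (rule mult_left_mono) simp
  finally show ?case by (simp add: power2_eq_square power_add algebra_simps)
qed

text \<open>Origin of the constant 12. With \<open>k = N - 1\<close> the worst exponent is
  \<open>2 * k + 1\<close>: for \<open>k = 1\<close> the power is 8, and for larger \<open>k\<close>
  it is at most 3/2 times the square of the bound 2.72 for \<open>exp 1\<close>.\<close>

lemma ratio_power_le_12:
  assumes "n < N" and "N \<ge> 2"
  shows "(real N / (real N - 1)) ^ (2 * n + 1) \<le> 12"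
proof -
  define k where "k = N - 1"
  have k: "k \<ge> 1" "real N = real k + 1" using assms by (auto simp: k_def of_nat_diff)
  define q where "q = 1 + 1 / real k"
  have q: "real N / (real N - 1) = q" "q \<ge> 1" using k by (auto simp: q_def field_simps)
  have "q ^ (2 * n + 1) \<le> q ^ (2 * k + 1)"
    using q assms by (intro power_increasing) (auto simp: k_def)
  also have "\<dots> = (q ^ k)\<^sup>2 * q"
    by (simp add: power_mult[symmetric] mult.commute)
  also have "\<dots> \<le> 12"
  proof (cases "k = 1")
    case True
    then show ?thesis by (simp add: q_def)
  next
    case False
    then have k2: "real k \<ge> 2" using k by auto
    have "q ^ k \<le> exp (1 / real k) ^ k"
      using exp_ge_add_one_self[of "1 / real k"] q by (intro power_mono) (auto simp: q_def)
    also have "\<dots> = exp 1"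
      using k2 by (simp add: exp_of_nat_mult[symmetric])
    also have "exp 1 \<le> (272/100 :: real)"
      using e_less_272 by simp
    finally have "(q ^ k)\<^sup>2 \<le> (272/100)\<^sup>2"
      using q by (intro power_mono) auto
    moreover have "q \<le> 3/2"
      using k2 by (simp add: q_def field_simps)
    ultimately have "(q ^ k)\<^sup>2 * q \<le> (272/100)\<^sup>2 * (3/2)"
      using q by (intro mult_mono) auto
    then show ?thesis by (simp add: power2_eq_square)
  qed
  finally show ?thesis using q by simp
qed

section \<open>Gram polynomials and their Gauss quadrature\<close>

abbreviation gram_inner :: "nat \<Rightarrow> real poly \<Rightarrow> real poly \<Rightarrow> real" where
  "gram_inner m p q \<equiv> \<Sum>j<m. poly p (gram_node m j) * poly q (gram_node m j)"

lemma gram_node_inj: "m \<ge> 2 \<Longrightarrow> inj (gram_node m)"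
  by (auto simp: gram_node_def inj_def)

lemma gram_node_mem: "m \<ge> 2 \<Longrightarrow> j < m \<Longrightarrow> gram_node m j \<in> {-1..1}"
  by (auto simp: gram_node_def field_simps)

lemma poly_eqI_gram_node:
  assumes "m \<ge> 2" and "degree p < m" and "degree q < m"
    and "\<And>j. j < m \<Longrightarrow> poly p (gram_node m j) = poly q (gram_node m j)"
  shows "p = q"
proof (rule poly_eqI_degree[of "gram_node m ` {..<m}"])
  show "degree p < card (gram_node m ` {..<m})" "degree q < card (gram_node m ` {..<m})"
    using assms inj_on_subset[OF gram_node_inj] by (simp_all add: card_image)
qed (use assms in auto)

text \<open>In the expansion of \<open>r\<close> in the orthonormal family only the term of index
  \<open>n\<close> contributes. This yields both orthogonality to lower degrees and the products
  with polynomials of the same degree.\<close>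

lemma gram_inner_eq:
  assumes p: "is_gram_family m p" and "n < m" and "degree r \<le> n"
  shows "gram_inner m (p n) r = coeff r n / lead_coeff (p n)"
proof -
  have deg: "degree (p k) = k" and lc: "coeff (p k) k > 0" if "k < m" for k
    using p that unfolding is_gram_family_def by metis+
  have inner: "gram_inner m (p k) (p l) = (if k = l then 1 else 0)" if "k < m" "l < m" for k l
    using p that unfolding is_gram_family_def by blast
  \<comment> \<open>The claim is relaxed to all \<open>k \<le> n\<close>, so that induction on
    \<open>k\<close> can strip one leading term at a time.\<close>
  have "gram_inner m (p n) r = (if k = n then coeff r n / coeff (p n) n else 0)"
    if "k \<le> n" "degree r \<le> k" for k r
    using that
  proof (induction k arbitrary: r)
    case 0
    then obtain c where c: "r = [:c:]" by (auto elim: degree_eq_zeroE)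
    obtain d where d: "p 0 = [:d:]" "d > 0"
      using deg[of 0] lc[of 0] \<open>n < m\<close> by (auto elim!: degree_eq_zeroE)
    have "gram_inner m (p n) r = c / d * gram_inner m (p n) (p 0)"
      using c d by (simp add: sum_distrib_left mult.commute)
    then show ?case using inner[of n 0] \<open>n < m\<close> c d by auto
  next
    case (Suc k)
    then have "Suc k < m" using \<open>n < m\<close> by simp
    note k = deg[OF this] lc[OF this]
    define c where "c = coeff r (Suc k) / coeff (p (Suc k)) (Suc k)"
    define s where "s = r - smult c (p (Suc k))"
    have "degree s \<le> k"
    proof (rule degree_le, intro allI impI)
      fix i assume "k < i"
      then consider "i = Suc k" | "i > Suc k" by linarith
      then show "coeff s i = 0"
        using k Suc.prems by cases (auto simp: s_def c_def coeff_eq_0)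
    qed
    then have "gram_inner m (p n) s = 0"
      using Suc.IH[of s] Suc.prems by simp
    moreover have "gram_inner m (p n) r = gram_inner m (p n) s + c * gram_inner m (p n) (p (Suc k))"
      by (simp add: s_def algebra_simps sum.distrib sum_distrib_left sum_subtractf)
    ultimately show ?case
      using inner[OF \<open>n < m\<close> \<open>Suc k < m\<close>] by (auto simp: c_def)
  qed
  from this[of n r] show ?thesis using assms deg by simp
qed

text \<open>Makes the definite description in \<open>gram_poly\<close> meaningful. By symmetry the
  two quotients of leading coefficients agree, so by positivity these coefficients are equal; then
  the difference has discrete norm zero and vanishes at \<open>m\<close> nodes.\<close>

lemma gram_family_unique:
  assumes "m \<ge> 2" and p: "is_gram_family m p" and q: "is_gram_family m q"
  shows "p = q"
proof
  fix n
  show "p n = q n"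
  proof (cases "n < m")
    case False
    then show ?thesis using p q by (simp add: is_gram_family_def)
  next
    case n: True
    have deg: "degree (p n) = n" "degree (q n) = n"
      and pos: "coeff (p n) n > 0" "coeff (q n) n > 0"
      and one: "gram_inner m (p n) (p n) = 1" "gram_inner m (q n) (q n) = 1"
      using p q n unfolding is_gram_family_def by metis+
    have pq: "gram_inner m (p n) (q n) = coeff (q n) n / coeff (p n) n"
      "gram_inner m (q n) (p n) = coeff (p n) n / coeff (q n) n"
      using gram_inner_eq[OF p n, of "q n"] gram_inner_eq[OF q n, of "p n"] deg by auto
    have sym: "gram_inner m (p n) (q n) = gram_inner m (q n) (p n)"
      by (simp add: mult.commute)
    then have "coeff (q n) n / coeff (p n) n = coeff (p n) n / coeff (q n) n"
      by (simp only: pq)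
    then have "(coeff (p n) n)\<^sup>2 = (coeff (q n) n)\<^sup>2"
      using pos by (simp add: field_simps power2_eq_square)
    then have "coeff (p n) n = coeff (q n) n"
      using pos by (simp add: power2_eq_iff_nonneg)
    then have "gram_inner m (p n) (q n) = 1" using pq pos by simp
    moreover have "(\<Sum>j<m. (poly (p n - q n) (gram_node m j))\<^sup>2) = gram_inner m (p n) (p n)
        - gram_inner m (p n) (q n) - gram_inner m (q n) (p n) + gram_inner m (q n) (q n)"
      by (simp add: power2_eq_square algebra_simps sum.distrib sum_subtractf sum_distrib_left)
    ultimately have "(\<Sum>j<m. (poly (p n - q n) (gram_node m j))\<^sup>2) = 0"
      using one sym by simp
    then have "\<forall>j\<in>{..<m}. (poly (p n - q n) (gram_node m j))\<^sup>2 = 0"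
      by (subst (asm) sum_nonneg_eq_0_iff) auto
    then show ?thesis
      using deg n \<open>m \<ge> 2\<close> by (intro poly_eqI_gram_node[of m]) auto
  qed
qed

text \<open>The normalised discrete Chebyshev polynomials, rescaled to the Gram nodes, form the
  family; the inverse squared leading coefficient is read off from \<open>coeff_dcheb\<close> and
  \<open>dcheb_norm\<close>.\<close>

lemma gram_family_exists:
  assumes m: "m \<ge> 2"
  obtains p where "is_gram_family m p"
    and "\<And>n. n < m \<Longrightarrow> 1 / (lead_coeff (p n))\<^sup>2 =
      (fact n) ^ 4 / fact (2 * n) * real ((m + n) choose (2 * n + 1)) * (2 / (real m - 1)) ^ (2 * n)"
proof
  \<comment> \<open>With this \<open>c\<close> the map \<open>x\<close> to
    \<open>c * (x + 1)\<close> sends the node of index \<open>j\<close> to \<open>j\<close>.\<close>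
  define c where "c = (real m - 1) / 2"
  have c: "c > 0" using m by (simp add: c_def)
  define g where "g n = pcompose (dcheb m n) [:c, c:]" for n
  define S where "S n = (\<Sum>x<m. (poly (dcheb m n) (real x))\<^sup>2)" for n
  define p where "p n = (if n < m then smult (1 / sqrt (S n)) (g n) else 0)" for n
  have g_node: "poly (g n) (gram_node m j) = poly (dcheb m n) (real j)" for n j
  proof -
    have "c * (2 * real j / (real m - 1)) = real j"
      using m by (simp add: c_def)
    then have "c + gram_node m j * c = real j"
      by (simp add: gram_node_def algebra_simps)
    then show ?thesis by (simp add: g_def poly_pcompose)
  qed
  have deg_g: "degree (g n) = n" for n
    using c by (simp add: g_def degree_pcompose degree_dcheb)
  have lc_g: "coeff (g n) n = fact (2 * n) / fact n * c ^ n" for n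
    using lead_coeff_comp[of "[:c, c:]" "dcheb m n"] c deg_g[of n]
    by (simp add: g_def coeff_dcheb degree_dcheb)
  have S: "S n > 0" if "n < m" for n
    using that unfolding S_def dcheb_norm by simp
  have deg_p: "degree (p n) = n" and lc_p: "coeff (p n) n = fact (2 * n) / fact n * c ^ n / sqrt (S n)"
    if "n < m" for n
    using that S[OF that] by (simp_all add: p_def deg_g lc_g)
  have orth: "gram_inner m (g n) (g k) = 0" if "k < n" for n k
    unfolding g_node using that by (intro dcheb_orthogonal) (simp add: degree_dcheb)
  have "gram_inner m (p n) (p k) = (if n = k then 1 else 0)" if "n < m" "k < m" for n k
  proof -
    have "gram_inner m (p n) (p k) = gram_inner m (g n) (g k) / (sqrt (S n) * sqrt (S k))"
      using that by (simp add: p_def sum_divide_distrib)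
    also have "\<dots> = (if n = k then 1 else 0)"
    proof (cases "n = k")
      case True
      then have "gram_inner m (g n) (g k) = S k"
        by (simp add: g_node S_def power2_eq_square)
      then show ?thesis using True S[OF \<open>k < m\<close>] by simp
    next
      case False
      have "gram_inner m (g n) (g k) = gram_inner m (g k) (g n)" by (simp add: mult.commute)
      then have "gram_inner m (g n) (g k) = 0"
        using orth[of k n] orth[of n k] False by (metis linorder_neqE_nat)
      then show ?thesis using False by simp
    qed
    finally show ?thesis .
  qed
  then show "is_gram_family m p"
    using S c by (simp add: is_gram_family_def deg_p lc_p) (simp add: p_def)
  fix n assume n: "n < m"
  have "1 / (coeff (p n) n)\<^sup>2 = S n * (fact n)\<^sup>2 / (fact (2 * n))\<^sup>2 * (1 / c) ^ (2 * n)"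
    using S[OF n] c unfolding lc_p[OF n]
    by (simp add: power_divide power_mult_distrib power_mult field_simps)
  also have "\<dots> = (fact n) ^ 4 / fact (2 * n) * real ((m + n) choose (2 * n + 1)) * (2 / (real m - 1)) ^ (2 * n)"
    unfolding S_def dcheb_norm by (simp add: c_def power2_eq_square power4_eq_xxxx field_simps)
  finally show "1 / (lead_coeff (p n))\<^sup>2 =
      (fact n) ^ 4 / fact (2 * n) * real ((m + n) choose (2 * n + 1)) * (2 / (real m - 1)) ^ (2 * n)"
    by (simp only: deg_p[OF n])
qed

lemma gram_poly:
  assumes m: "m \<ge> 2"
  shows is_gram_family_gram_poly: "is_gram_family m (gram_poly m)"
    and gram_lc_eq: "n < m \<Longrightarrow> 1 / (gram_lc m n)\<^sup>2 =
      (fact n) ^ 4 / fact (2 * n) * real ((m + n) choose (2 * n + 1)) * (2 / (real m - 1)) ^ (2 * n)"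
proof -
  obtain p where p: "is_gram_family m p" "\<And>n. n < m \<Longrightarrow> 1 / (lead_coeff (p n))\<^sup>2 =
      (fact n) ^ 4 / fact (2 * n) * real ((m + n) choose (2 * n + 1)) * (2 / (real m - 1)) ^ (2 * n)"
    using gram_family_exists[OF m] by blast
  have "(THE p. is_gram_family m p) = p"
    using gram_family_unique[OF m _ p(1)] p(1) by blast
  then have "gram_poly m = p"
    by (simp add: gram_poly_def fun_eq_iff)
  with p show "is_gram_family m (gram_poly m)" and "n < m \<Longrightarrow> 1 / (gram_lc m n)\<^sup>2 =
      (fact n) ^ 4 / fact (2 * n) * real ((m + n) choose (2 * n + 1)) * (2 / (real m - 1)) ^ (2 * n)"
    by (simp_all add: gram_lc_def)
qed

section \<open>Zeros of the Gram polynomials, Gauss weights and quadrature error\<close>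

text \<open>The roots collected in \<open>Z\<close> are those at which \<open>p\<close> changes sign.\<close>

lemma poly_sign_changes:
  fixes p :: "real poly"
  assumes "p \<noteq> 0"
  shows "\<exists>Z. finite Z \<and> Z \<subseteq> {a..b} \<and> (\<forall>z\<in>Z. poly p z = 0) \<and>
    ((\<forall>x\<in>{a..b}. poly p x * (\<Prod>z\<in>Z. x - z) \<ge> 0) \<or> (\<forall>x\<in>{a..b}. poly p x * (\<Prod>z\<in>Z. x - z) \<le> 0))"
  using assms
proof (induction "degree p" arbitrary: p)
  case 0
  then obtain c where "p = [:c:]" by (metis degree_eq_zeroE)
  then show ?case by (intro exI[of _ "{}"]) (auto simp: linear)
next
  case (Suc d)
  show ?case
  proof (cases "\<exists>z\<in>{a..b}. poly p z = 0")
    case False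
    have "poly p x * poly p y > 0" if "x \<in> {a..b}" "y \<in> {a..b}" "x < y" for x y
    proof (rule ccontr)
      assume "\<not> poly p x * poly p y > 0"
      then have "poly p x * poly p y < 0"
        using False that by (simp add: not_less order_le_less)
      then show False using poly_IVT[OF \<open>x < y\<close>] False that by fastforce
    qed
    then have "poly p x * poly p y > 0" if "x \<in> {a..b}" "y \<in> {a..b}" for x y
      using that False by (cases x y rule: linorder_cases) (auto simp: mult.commute zero_less_mult_iff linorder_neq_iff)
    then have "(\<forall>x\<in>{a..b}. poly p x \<ge> 0) \<or> (\<forall>x\<in>{a..b}. poly p x \<le> 0)"
      by (meson less_imp_le linear mult_nonneg_nonpos2 not_less)
    then show ?thesis by (intro exI[of _ "{}"]) auto
  next
    case True
    then obtain z where z: "z \<in> {a..b}" "poly p z = 0" by blast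
    then obtain q where q: "p = [:- z, 1:] * q" by (auto simp: poly_eq_0_iff_dvd elim: dvdE)
    then have "q \<noteq> 0" using Suc.prems by auto
    then have "degree ([:- z, 1:] * q) = degree [:- z, 1:] + degree q"
      by (intro degree_mult_eq) auto
    then have "degree p = Suc (degree q)" unfolding q by (simp del: mult_pCons_left)
    then have "d = degree q" using Suc.hyps by simp
    then obtain Z where Z: "finite Z" "Z \<subseteq> {a..b}" "\<forall>z\<in>Z. poly q z = 0"
      "(\<forall>x\<in>{a..b}. poly q x * (\<Prod>z\<in>Z. x - z) \<ge> 0) \<or> (\<forall>x\<in>{a..b}. poly q x * (\<Prod>z\<in>Z. x - z) \<le> 0)"
      using Suc.hyps(1)[OF _ \<open>q \<noteq> 0\<close>] by auto
    \<comment> \<open>The extra factor \<open>x - z\<close> toggles whether the sign changes at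
      \<open>z\<close>: if \<open>z\<close> was collected for \<open>q\<close> it is dropped,
      otherwise it is added and contributes a square.\<close>
    show ?thesis
    proof (cases "z \<in> Z")
      case True
      have "poly p x * (\<Prod>z\<in>Z - {z}. x - z) = poly q x * (\<Prod>z\<in>Z. x - z)" for x
        by (simp add: q prod.remove[OF Z(1) True] algebra_simps)
      then show ?thesis
        using Z by (intro exI[of _ "Z - {z}"]) (auto simp: q)
    next
      case False
      have eq: "poly p x * (\<Prod>z\<in>insert z Z. x - z) = (x - z)\<^sup>2 * (poly q x * (\<Prod>z\<in>Z. x - z))" for x
        using False Z(1) by (simp add: q power2_eq_square algebra_simps)
      show ?thesis
      proof (intro exI[of _ "insert z Z"] conjI)
        show "(\<forall>x\<in>{a..b}. poly p x * (\<Prod>z\<in>insert z Z. x - z) \<ge> 0) \<or>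
            (\<forall>x\<in>{a..b}. poly p x * (\<Prod>z\<in>insert z Z. x - z) \<le> 0)"
          unfolding eq using Z(4) by (meson mult_nonneg_nonneg mult_nonneg_nonpos zero_le_power2)
      qed (use Z z in \<open>auto simp: q\<close>)
    qed
  qed
qed

text \<open>With fewer than \<open>M\<close> sign changes in the interval, \<open>P\<close> would be
  orthogonal to \<open>Q\<close>, while \<open>P * Q\<close> keeps one sign at the nodes. The
  product would then vanish at every node, and so would \<open>P\<close>, whose degree is below
  \<open>m\<close>.\<close>

lemma gram_poly_roots:
  assumes "0 < M" and "M < m"
  defines "Z \<equiv> {x. poly (gram_poly m M) x = 0}"
  shows "finite Z" and "Z \<subseteq> {-1..1}" and "card Z = M"
    and "gram_poly m M = smult (gram_lc m M) (\<Prod>z\<in>Z. [:- z, 1:])"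
proof -
  define P where "P = gram_poly m M"
  have m: "m \<ge> 2" using assms by simp
  note fam = is_gram_family_gram_poly[OF m]
  have deg: "degree P = M" and pos: "lead_coeff P > 0"
    using fam \<open>M < m\<close> unfolding is_gram_family_def P_def by metis+
  then have "P \<noteq> 0" by auto
  then obtain Y where Y: "finite Y" "Y \<subseteq> {-1..1}" "\<forall>z\<in>Y. poly P z = 0"
    "(\<forall>x\<in>{-1..1}. poly P x * (\<Prod>z\<in>Y. x - z) \<ge> 0) \<or> (\<forall>x\<in>{-1..1}. poly P x * (\<Prod>z\<in>Y. x - z) \<le> 0)"
    using poly_sign_changes[of P "-1" 1] by blast
  define Q where "Q = (\<Prod>z\<in>Y. [:- z, 1:])"
  have Q: "poly Q x = (\<Prod>z\<in>Y. x - z)" for x by (simp add: Q_def poly_prod)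
  have fin: "finite Z" using poly_roots_finite[OF \<open>P \<noteq> 0\<close>] by (simp add: Z_def P_def)
  have YZ: "Y \<subseteq> Z" using Y by (auto simp: Z_def P_def)
  have card_le: "card Z \<le> M"
    using card_poly_roots_bound[OF \<open>P \<noteq> 0\<close>] deg by (simp add: Z_def P_def)
  have "card Y \<ge> M"
  proof (rule ccontr)
    assume "\<not> card Y \<ge> M"
    then have "degree Q < M" by (simp add: Q_def)
    then have "gram_inner m P Q = 0"
      using gram_inner_eq[OF fam \<open>M < m\<close>, of Q] by (simp add: P_def coeff_eq_0)
    have "poly P (gram_node m j) * poly Q (gram_node m j) = 0" if "j < m" for j
    proof -
      note mem = gram_node_mem[OF m]
      have "\<forall>j\<in>{..<m}. poly P (gram_node m j) * poly Q (gram_node m j) = 0"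
        using Y(4)
      proof
        assume "\<forall>x\<in>{-1..1}. poly P x * (\<Prod>z\<in>Y. x - z) \<ge> 0"
        then show ?thesis
          using \<open>gram_inner m P Q = 0\<close> mem by (subst (asm) sum_nonneg_eq_0_iff) (auto simp: Q)
      next
        assume "\<forall>x\<in>{-1..1}. poly P x * (\<Prod>z\<in>Y. x - z) \<le> 0"
        then show ?thesis
          using sum_nonneg_eq_0_iff[of "{..<m}" "\<lambda>j. - (poly P (gram_node m j) * poly Q (gram_node m j))"]
            \<open>gram_inner m P Q = 0\<close> mem by (simp add: Q sum_negf)
      qed
      then show ?thesis using that by blast
    qed
    \<comment> \<open>The roots of \<open>Q\<close> are among those of \<open>P\<close>, so a zero
      of the product is always a zero of \<open>P\<close>.\<close>
    moreover have "poly P x = 0" if "poly Q x = 0" for x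
      using that Y(1,3) by (auto simp: Q)
    ultimately have "P = 0"
      using m deg \<open>M < m\<close> by (intro poly_eqI_gram_node[of m]) auto
    with \<open>P \<noteq> 0\<close> show False by contradiction
  qed
  then have "Y = Z"
    using card_le fin YZ by (intro card_seteq) auto
  show "finite Z" by fact
  show "Z \<subseteq> {-1..1}" using Y \<open>Y = Z\<close> by simp
  show card: "card Z = M" using card_le \<open>card Y \<ge> M\<close> \<open>Y = Z\<close> by simp
  show "gram_poly m M = smult (gram_lc m M) (\<Prod>z\<in>Z. [:- z, 1:])"
  proof (rule poly_eqI_degree_lead_coeff[of _ M _ Z])
    show "coeff (gram_poly m M) M = coeff (smult (gram_lc m M) (\<Prod>z\<in>Z. [:- z, 1:])) M"
      using lead_coeff_prod_linear[of Z] card deg by (simp add: gram_lc_def P_def)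
    show "poly (gram_poly m M) z = poly (smult (gram_lc m M) (\<Prod>z\<in>Z. [:- z, 1:])) z" if "z \<in> Z" for z
      using that fin by (auto simp: Z_def poly_prod)
  qed (use card deg in \<open>auto simp: P_def intro: order_trans[OF degree_smult_le]\<close>)
qed

text \<open>The weights are interpolatory: with \<open>u = p\<^sub>M / (x - \<xi>)\<close>, both sides come from evaluating
  \<open>\<Sum>\<^sub>j u(x\<^sub>j) p\<^bsub>M-1\<^esub>(x\<^sub>j)\<close>, once by comparing leading coefficients and once by replacing \<open>p\<^bsub>M-1\<^esub>\<close>
  with its value at \<open>\<xi>\<close>, which changes it by a multiple of \<open>x - \<xi>\<close>.\<close>

lemma gram_weight_eq:
  assumes M: "0 < M" "M < m"
  defines "Z \<equiv> {x. poly (gram_poly m M) x = 0}"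
  assumes \<xi>: "\<xi> \<in> Z"
  defines "L \<equiv> \<Prod>z\<in>Z - {\<xi>}. [:- z, 1:]"
  shows "real m / 2 * gram_weight m M \<xi> = (\<Sum>j<m. poly L (gram_node m j)) / poly L \<xi>"
    and "poly L \<xi> \<noteq> 0"
proof -
  have m: "m \<ge> 2" "M - 1 < m" using M by simp_all
  note fam = is_gram_family_gram_poly[OF m(1)]
  note Z = gram_poly_roots[OF M, folded Z_def]
  have lc: "gram_lc m M > 0" "gram_lc m (M - 1) > 0"
    using fam M m unfolding is_gram_family_def gram_lc_def by blast+
  have P: "gram_poly m M = smult (gram_lc m M) ([:- \<xi>, 1:] * L)"
    using Z(4) unfolding L_def prod.remove[OF Z(1) \<xi>] .
  have dP: "poly (pderiv (gram_poly m M)) \<xi> = gram_lc m M * poly L \<xi>"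
    unfolding P pderiv_smult pderiv_mult by (simp add: pderiv_pCons)
  have deg: "degree L = M - 1" and lcL: "coeff L (M - 1) = 1"
    using lead_coeff_prod_linear[of "Z - {\<xi>}"] Z \<xi> unfolding L_def by simp_all
  show L: "poly L \<xi> \<noteq> 0" using Z(1) by (auto simp: L_def poly_prod)
  define p where "p = gram_poly m (M - 1)"
  define r where "r = poly p \<xi>"
  obtain s where s: "p - [:r:] = [:- \<xi>, 1:] * s"
  proof -
    have "poly (p - [:r:]) \<xi> = 0" by (simp add: r_def)
    then show thesis using that by (auto simp only: poly_eq_0_iff_dvd elim: dvdE)
  qed
  have deg_p: "degree p = M - 1"
    using fam m unfolding is_gram_family_def p_def by blast
  have deg_s: "degree s < M"
  proof (cases "s = 0")
    case False
    then have "Suc (degree s) = degree ([:- \<xi>, 1:] * s)"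
      using degree_mult_eq[of "[:- \<xi>, 1:]" s] by (simp del: mult_pCons_left)
    also have "\<dots> \<le> M - 1" unfolding s[symmetric] using deg_p by (intro degree_diff_le) auto
    finally show ?thesis by simp
  qed (use M in simp)
  have "gram_inner m (gram_poly m M) s = 0"
    using gram_inner_eq[OF fam M(2), of s] deg_s by (simp add: coeff_eq_0)
  moreover have "gram_inner m p L = 1 / gram_lc m (M - 1)"
    using gram_inner_eq[OF fam m(2), of L] deg lcL by (simp add: p_def gram_lc_def)
  \<comment> \<open>Multiplying \<open>p = (x - \<xi>) s + r\<close> by \<open>L\<close> and the
    leading coefficient of the Gram polynomial rebuilds that polynomial in front of
    \<open>s\<close>.\<close>
  moreover have "gram_lc m M * gram_inner m p L =
      gram_inner m (gram_poly m M) s + gram_lc m M * r * (\<Sum>j<m. poly L (gram_node m j))"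
  proof -
    have p: "p = [:- \<xi>, 1:] * s + [:r:]" using s by (simp add: algebra_simps)
    show ?thesis unfolding p P
      by (simp add: sum_distrib_left sum.distrib[symmetric] algebra_simps)
  qed
  ultimately have "r * (\<Sum>j<m. poly L (gram_node m j)) * gram_lc m (M - 1) = 1"
    using lc by (simp add: field_simps)
  \<comment> \<open>This shows that the value of the lower Gram polynomial in the denominator of the
    weight is nonzero.\<close>
  moreover from this have "r \<noteq> 0" by auto
  ultimately have "(\<Sum>j<m. poly L (gram_node m j)) = 1 / (r * gram_lc m (M - 1))"
    using lc(2) by (simp add: eq_divide_eq mult_ac)
  then show "real m / 2 * gram_weight m M \<xi> = (\<Sum>j<m. poly L (gram_node m j)) / poly L \<xi>"
    using L lc m \<open>r \<noteq> 0\<close> unfolding gram_weight_def dP p_def[symmetric] r_def[symmetric]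
    by (simp add: field_simps)
qed

text \<open>Gauss's argument: in \<open>q = P * s + r\<close> the first term has node sum zero by
  orthogonality and vanishes at the roots, while \<open>r\<close> is its own Lagrange interpolant at
  the roots.\<close>

lemma gram_quadrature_exact:
  assumes M: "0 < M" "M < m" and q: "degree q < 2 * M"
  defines "Z \<equiv> {x. poly (gram_poly m M) x = 0}"
  shows "(\<Sum>j<m. poly q (gram_node m j)) = (\<Sum>\<xi>\<in>Z. real m / 2 * gram_weight m M \<xi> * poly q \<xi>)"
proof -
  define P where "P = gram_poly m M"
  have m: "m \<ge> 2" using M by simp
  note fam = is_gram_family_gram_poly[OF m]
  note Z = gram_poly_roots[OF M, folded Z_def]
  note weight = gram_weight_eq[OF M, folded Z_def]
  have deg: "degree P = M"
    using fam \<open>M < m\<close> unfolding is_gram_family_def P_def by blast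
  then have "P \<noteq> 0" using M by auto
  define s where "s = q div P"
  define r where "r = q mod P"
  have eq: "q = P * s + r" by (simp add: s_def r_def)
  have deg_r: "degree r < M"
    using degree_mod_less[OF \<open>P \<noteq> 0\<close>, of q] deg M by (auto simp: r_def)
  have deg_s: "degree s < M"
  proof (cases "s = 0")
    case False
    have "M + degree s = degree (P * s)" using False \<open>P \<noteq> 0\<close> deg by (simp add: degree_mult_eq)
    also have "P * s = q - r" using eq by simp
    also have "degree (q - r) < 2 * M" using q deg_r by (intro degree_diff_less) auto
    finally show ?thesis by simp
  qed (use M in simp)
  define L where "L \<xi> = (\<Prod>z\<in>Z - {\<xi>}. [:- z, 1:])" for \<xi>
  have L0: "poly (L \<xi>) z = 0" if "z \<in> Z" "z \<noteq> \<xi>" for z \<xi>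
    using that Z(1) by (auto simp: L_def poly_prod)
  have r: "r = (\<Sum>\<xi>\<in>Z. smult (poly r \<xi> / poly (L \<xi>) \<xi>) (L \<xi>))"
  proof (rule poly_eqI_degree[of Z])
    fix z assume z: "z \<in> Z"
    have "poly (\<Sum>\<xi>\<in>Z. smult (poly r \<xi> / poly (L \<xi>) \<xi>) (L \<xi>)) z = (\<Sum>\<xi>\<in>Z. if \<xi> = z then poly r z else 0)"
      unfolding poly_sum using L0[OF z] weight(2)[OF z, folded L_def] by (intro sum.cong) auto
    then show "poly r z = poly (\<Sum>\<xi>\<in>Z. smult (poly r \<xi> / poly (L \<xi>) \<xi>) (L \<xi>)) z"
      using z Z(1) by simp
  next
    have deg_L: "degree (smult c (L \<xi>)) \<le> M - 1" if "\<xi> \<in> Z" for c \<xi>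
      using that Z by (intro order_trans[OF degree_smult_le]) (simp add: L_def)
    have "degree (\<Sum>\<xi>\<in>Z. smult (poly r \<xi> / poly (L \<xi>) \<xi>) (L \<xi>)) \<le> M - 1"
      by (intro degree_sum_le Z(1) deg_L)
    then show "degree (\<Sum>\<xi>\<in>Z. smult (poly r \<xi> / poly (L \<xi>) \<xi>) (L \<xi>)) < card Z"
      using Z(3) M by simp
  qed (use deg_r Z in simp)
  have "poly r x = (\<Sum>\<xi>\<in>Z. poly r \<xi> / poly (L \<xi>) \<xi> * poly (L \<xi>) x)" for x
    using arg_cong[OF r, of "\<lambda>p. poly p x"] unfolding poly_sum poly_smult .
  then have "(\<Sum>j<m. poly r (gram_node m j)) = (\<Sum>j<m. \<Sum>\<xi>\<in>Z. poly r \<xi> / poly (L \<xi>) \<xi> * poly (L \<xi>) (gram_node m j))"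
    by (intro sum.cong refl)
  also have "\<dots> = (\<Sum>\<xi>\<in>Z. poly r \<xi> / poly (L \<xi>) \<xi> * (\<Sum>j<m. poly (L \<xi>) (gram_node m j)))"
    by (subst sum.swap) (simp add: sum_distrib_left)
  also have "\<dots> = (\<Sum>\<xi>\<in>Z. real m / 2 * gram_weight m M \<xi> * poly r \<xi>)"
    using weight(1)[folded L_def] by (intro sum.cong) auto
  also have "\<dots> = (\<Sum>\<xi>\<in>Z. real m / 2 * gram_weight m M \<xi> * poly q \<xi>)"
    by (intro sum.cong) (auto simp: eq P_def Z_def)
  finally have "(\<Sum>j<m. poly r (gram_node m j)) = (\<Sum>\<xi>\<in>Z. real m / 2 * gram_weight m M \<xi> * poly q \<xi>)" .
  moreover have "gram_inner m P s = 0"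
    using gram_inner_eq[OF fam M(2), of s] deg_s by (simp add: P_def coeff_eq_0)
  ultimately show ?thesis
    unfolding eq by (simp add: sum.distrib)
qed

text \<open>The rule is exact for the Hermite interpolant \<open>H\<close>, which agrees with the
  function at the roots. The error is therefore the node sum of the Hermite remainder, and
  orthonormality sums the squares of the Gram polynomial to 1.\<close>

lemma gram_quadrature_error:
  fixes fd :: "nat \<Rightarrow> real \<Rightarrow> real"
  assumes M: "0 < M" "M < m"
    and der: "\<And>i x. i < 2 * M \<Longrightarrow> x \<in> {-1..1} \<Longrightarrow>
           (fd i has_vector_derivative fd (Suc i) x) (at x within {-1..1})"
    and bound: "\<And>x. x \<in> {-1..1} \<Longrightarrow> \<bar>fd (2 * M) x\<bar> \<le> B"
  defines "Z \<equiv> {x. poly (gram_poly m M) x = 0}"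
  shows "\<bar>(\<Sum>j<m. fd 0 (gram_node m j)) - (\<Sum>\<xi>\<in>Z. real m / 2 * gram_weight m M \<xi> * fd 0 \<xi>)\<bar>
    \<le> B / fact (2 * M) / (gram_lc m M)\<^sup>2"
proof -
  have m: "m \<ge> 2" using M by simp
  note fam = is_gram_family_gram_poly[OF m]
  note Z = gram_poly_roots[OF M, folded Z_def]
  obtain H where H: "degree H \<le> 2 * card Z - 1" "\<forall>z\<in>Z. poly H z = fd 0 z \<and> poly (pderiv H) z = fd 1 z"
    using Hermite_interpolant[OF Z(1), of "fd 0" "fd 1"] by blast
  have degH: "degree H < 2 * M" using H(1) Z(3) M by simp
  have lc: "gram_lc m M > 0"
    using fam M unfolding is_gram_family_def gram_lc_def by blast
  have W: "(\<Prod>z\<in>Z. x - z)\<^sup>2 = (poly (gram_poly m M) x)\<^sup>2 / (gram_lc m M)\<^sup>2" for x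
    by (subst Z(4)) (use lc in \<open>simp add: poly_prod power_mult_distrib\<close>)
  have "(\<Sum>\<xi>\<in>Z. real m / 2 * gram_weight m M \<xi> * fd 0 \<xi>) = (\<Sum>j<m. poly H (gram_node m j))"
    unfolding gram_quadrature_exact[OF M degH] Z_def[symmetric] using H(2) by (intro sum.cong) auto
  then have "\<bar>(\<Sum>j<m. fd 0 (gram_node m j)) - (\<Sum>\<xi>\<in>Z. real m / 2 * gram_weight m M \<xi> * fd 0 \<xi>)\<bar>
      = \<bar>\<Sum>j<m. fd 0 (gram_node m j) - poly H (gram_node m j)\<bar>"
    by (simp add: sum_subtractf)
  also have "\<dots> \<le> (\<Sum>j<m. \<bar>fd 0 (gram_node m j) - poly H (gram_node m j)\<bar>)"
    by (rule sum_abs)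
  also have "\<dots> \<le> (\<Sum>j<m. B / fact (2 * M) * ((poly (gram_poly m M) (gram_node m j))\<^sup>2 / (gram_lc m M)\<^sup>2))"
  proof (rule sum_mono)
    fix j assume j: "j \<in> {..<m}"
    have "\<bar>fd 0 (gram_node m j) - poly H (gram_node m j)\<bar>
        \<le> B / fact (2 * card Z) * (\<Prod>z\<in>Z. gram_node m j - z)\<^sup>2"
      by (rule Hermite_error[where fd = fd and a = "-1" and b = 1])
        (use Z M der bound degH H(2) gram_node_mem[OF m] j in auto)
    then show "\<bar>fd 0 (gram_node m j) - poly H (gram_node m j)\<bar> \<le>
        B / fact (2 * M) * ((poly (gram_poly m M) (gram_node m j))\<^sup>2 / (gram_lc m M)\<^sup>2)"
      using Z(3) by (simp only: W)
  qed
  also have "\<dots> = B / fact (2 * M) / (gram_lc m M)\<^sup>2 * gram_inner m (gram_poly m M) (gram_poly m M)"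
    by (simp add: sum_distrib_left power2_eq_square mult_ac)
  also have "gram_inner m (gram_poly m M) (gram_poly m M) = 1"
    using fam M(2) unfolding is_gram_family_def by simp
  finally show ?thesis by simp
qed

section \<open>Error bound for Banach-space valued functions\<close>

lemma affine_ab_mem:
  assumes "a < b" and "x \<in> {-1..1}"
  shows "affine_ab a b x \<in> {a..b}"
proof -
  have "(b - a) / 2 * (x + 1) \<ge> 0" using assms by simp
  moreover have "(b - a) / 2 * (x + 1) \<le> (b - a) / 2 * 2"
    using assms by (intro mult_left_mono) auto
  ultimately show ?thesis by (simp add: affine_ab_def)
qed

lemma has_vector_derivative_affine_ab:
  fixes F F' :: "real \<Rightarrow> 'a::real_normed_vector"
  assumes "a < b" and x: "x \<in> {-1..1}"
    and der: "\<And>t. t \<in> {a..b} \<Longrightarrow> (F has_vector_derivative F' t) (at t within {a..b})"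
  shows "((\<lambda>x. F (affine_ab a b x)) has_vector_derivative ((b - a) / 2) *\<^sub>R F' (affine_ab a b x)) (at x within {-1..1})"
proof -
  have "(affine_ab a b has_vector_derivative (b - a) / 2) (at x within {-1..1})"
    unfolding affine_ab_def has_real_derivative_iff_has_vector_derivative[symmetric]
    by (auto intro!: derivative_eq_intros)
  moreover have "(F has_vector_derivative F' (affine_ab a b x)) (at (affine_ab a b x) within affine_ab a b ` {-1..1})"
    using affine_ab_mem[OF \<open>a < b\<close>] x by (intro has_vector_derivative_within_subset[OF der]) auto
  ultimately show ?thesis
    using vector_diff_chain_within[of "affine_ab a b"] by (simp add: o_def)
qed

text \<open>The powers of two from the affine map and from the leading coefficient cancel, leaving a
  factor \<open>K\<close> independent of \<open>m\<close> times
  \<open>C / D ^ (2 * M + 1)\<close>.\<close>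

lemma gram_error_constant_le:
  assumes "a < b" and "A \<ge> 0" and "M < m" and "m \<ge> 2"
  shows "(b - a) / (real m - 1) * (A * ((b - a) / 2) ^ (2 * M) / fact (2 * M) / (gram_lc m M)\<^sup>2)
         \<le> 12 * A * (b - a) ^ (2 * M + 1) * (fact M) ^ 4
             / ((2 * real M + 1) * (fact (2 * M)) ^ 3)"
proof -
  define C where "C = real ((m + M) choose (2 * M + 1))"
  define D where "D = real m - 1"
  \<comment> \<open>This is the factorial of \<open>2 * M + 1\<close>, split as in the target
    bound.\<close>
  define N where "N = (2 * real M + 1) * fact (2 * M)"
  have N: "N > 0" by (simp add: N_def add_pos_nonneg)
  have D: "D > 0" using assms by (simp add: D_def)
  have "real (fact (2 * M + 1) * ((m + M) choose (2 * M + 1))) \<le> real (m ^ (2 * M + 1))"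
    using fact_mult_choose_le[OF \<open>M < m\<close>] by (rule of_nat_mono)
  then have "N * C \<le> real m ^ (2 * M + 1)"
    by (simp add: C_def N_def algebra_simps)
  then have "N * C / D ^ (2 * M + 1) \<le> (real m / D) ^ (2 * M + 1)"
    unfolding power_divide using D by (intro divide_right_mono) auto
  also have "\<dots> \<le> 12"
    unfolding D_def by (rule ratio_power_le_12[OF \<open>M < m\<close> \<open>m \<ge> 2\<close>])
  finally have C: "C / D ^ (2 * M + 1) \<le> 12 / N"
    using N by (simp add: pos_le_divide_eq mult.commute)
  define K where "K = A * (b - a) ^ (2 * M + 1) * (fact M) ^ 4 / (fact (2 * M))\<^sup>2"
  have "1 / (gram_lc m M)\<^sup>2 = (fact M) ^ 4 / fact (2 * M) * C * (2 / D) ^ (2 * M)"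
    unfolding C_def D_def by (rule gram_lc_eq[OF \<open>m \<ge> 2\<close> \<open>M < m\<close>])
  then have "(b - a) / D * (A * ((b - a) / 2) ^ (2 * M) / fact (2 * M) / (gram_lc m M)\<^sup>2)
      = (b - a) / D * (A * ((b - a) / 2) ^ (2 * M) / fact (2 * M) * ((fact M) ^ 4 / fact (2 * M) * C * (2 / D) ^ (2 * M)))"
    by (metis divide_inverse inverse_eq_divide)
  also have "\<dots> = K * (C / D ^ (2 * M + 1))"
    using D by (simp add: K_def power_divide power2_eq_square field_simps)
  also have "\<dots> \<le> K * (12 / N)"
    using assms by (intro mult_left_mono[OF C]) (simp add: K_def)
  also have "\<dots> = 12 * A * (b - a) ^ (2 * M + 1) * (fact M) ^ 4
             / ((2 * real M + 1) * (fact (2 * M)) ^ 3)"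
    by (simp add: K_def N_def power2_eq_square power3_eq_cube mult_ac)
  finally show ?thesis by (simp only: D_def)
qed

text \<open>\<open>Fd\<close> carries the successive derivatives, one-sided at the endpoints. A
  complex Banach space is covered through its underlying real structure.\<close>

theorem theorem3p4:
  fixes F :: "real \<Rightarrow> 'a::banach"
    and Fd :: "nat \<Rightarrow> real \<Rightarrow> 'a"
    and M m :: nat and a b A :: real
  assumes "1 \<le> M" and "M < m" and "a < b"
    and "Fd 0 = F"
    and "\<And>i t. i < 2 * M \<Longrightarrow> t \<in> {a..b} \<Longrightarrow>
           (Fd i has_vector_derivative Fd (Suc i) t) (at t within {a..b})"
    and "\<And>t. t \<in> {a..b} \<Longrightarrow> norm (Fd (2 * M) t) \<le> A"
  shows "norm (((b - a) / (real m - 1)) *\<^sub>R (\<Sum>j<m. F (affine_ab a b (gram_node m j)))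
              - (real m * (b - a) / (2 * (real m - 1))) *\<^sub>R gram_quad m M a b F)
         \<le> 12 * A * (b - a) ^ (2 * M + 1) * (fact M) ^ 4
             / ((2 * real M + 1) * (fact (2 * M)) ^ 3)"
proof -
  have m: "m \<ge> 2" and M: "0 < M" using assms(1,2) by simp_all
  define h where "h = (b - a) / 2"
  have h: "h > 0" using \<open>a < b\<close> by (simp add: h_def)
  define Z where "Z = {x. poly (gram_poly m M) x = 0}"
  \<comment> \<open>The factor \<open>m / 2\<close> is moved into the weights, so that the claimed
    difference is \<open>E\<close> times \<open>(b - a) / (m - 1)\<close> and the real error bound
    fits directly.\<close>
  define E where "E = (\<Sum>j<m. F (affine_ab a b (gram_node m j)))
      - (\<Sum>\<xi>\<in>Z. (real m / 2 * gram_weight m M \<xi>) *\<^sub>R F (affine_ab a b \<xi>))"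
  obtain \<phi> where \<phi>: "bounded_linear \<phi>" "\<And>x. \<bar>\<phi> x\<bar> \<le> norm x" "\<phi> E = norm E"
    using norming_functional[of E] by blast
  interpret \<phi>: bounded_linear \<phi> by fact
  \<comment> \<open>The derivatives of the real function obtained by applying \<phi> to
    \<open>F\<close> after the affine map; each differentiation contributes a factor
    \<open>h\<close> by the chain rule.\<close>
  define fd where "fd i x = \<phi> (h ^ i *\<^sub>R Fd i (affine_ab a b x))" for i x
  have "norm E = (\<Sum>j<m. fd 0 (gram_node m j)) - (\<Sum>\<xi>\<in>Z. real m / 2 * gram_weight m M \<xi> * fd 0 \<xi>)"
    unfolding \<phi>(3)[symmetric] by (simp add: E_def \<phi>.diff \<phi>.sum \<phi>.scaleR fd_def \<open>Fd 0 = F\<close>)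
  also have "\<dots> \<le> A * h ^ (2 * M) / fact (2 * M) / (gram_lc m M)\<^sup>2"
    unfolding Z_def
  proof (rule order_trans[OF abs_ge_self gram_quadrature_error[OF M \<open>M < m\<close>]])
    fix i and x :: real assume i: "i < 2 * M" and x: "x \<in> {-1..1}"
    have "((\<lambda>x. Fd i (affine_ab a b x)) has_vector_derivative h *\<^sub>R Fd (Suc i) (affine_ab a b x)) (at x within {-1..1})"
      unfolding h_def by (intro has_vector_derivative_affine_ab \<open>a < b\<close> x assms(5)[OF i])
    from \<phi>.has_vector_derivative[OF bounded_linear.has_vector_derivative[OF bounded_linear_scaleR_right this, of "h ^ i"]]
    show "(fd i has_vector_derivative fd (Suc i) x) (at x within {-1..1})"
      unfolding fd_def by (simp add: mult.commute)
  next
    fix x :: real assume "x \<in> {-1..1}"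
    then have "affine_ab a b x \<in> {a..b}" by (rule affine_ab_mem[OF \<open>a < b\<close>])
    from assms(6)[OF this] have "norm (h ^ (2 * M) *\<^sub>R Fd (2 * M) (affine_ab a b x)) \<le> A * h ^ (2 * M)"
      using h by (simp add: mult.commute)
    then show "\<bar>fd (2 * M) x\<bar> \<le> A * h ^ (2 * M)"
      unfolding fd_def by (rule order_trans[OF \<phi>(2)])
  qed
  finally have E: "norm E \<le> A * h ^ (2 * M) / fact (2 * M) / (gram_lc m M)\<^sup>2" .
  have "A \<ge> 0"
    using order_trans[OF norm_ge_zero assms(6)[of a]] \<open>a < b\<close> by simp
  have "((b - a) / (real m - 1)) *\<^sub>R (\<Sum>j<m. F (affine_ab a b (gram_node m j)))
      - (real m * (b - a) / (2 * (real m - 1))) *\<^sub>R gram_quad m M a b F = ((b - a) / (real m - 1)) *\<^sub>R E"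
    using m by (simp add: E_def gram_quad_def Z_def scaleR_diff_right scaleR_sum_right mult_ac)
  then have "norm (((b - a) / (real m - 1)) *\<^sub>R (\<Sum>j<m. F (affine_ab a b (gram_node m j)))
      - (real m * (b - a) / (2 * (real m - 1))) *\<^sub>R gram_quad m M a b F) = (b - a) / (real m - 1) * norm E"
    using m \<open>a < b\<close> by simp
  also have "\<dots> \<le> (b - a) / (real m - 1) * (A * h ^ (2 * M) / fact (2 * M) / (gram_lc m M)\<^sup>2)"
    using m \<open>a < b\<close> by (intro mult_left_mono[OF E]) simp
  also have "\<dots> \<le> 12 * A * (b - a) ^ (2 * M + 1) * (fact M) ^ 4
             / ((2 * real M + 1) * (fact (2 * M)) ^ 3)"
    unfolding h_def by (rule gram_error_constant_le[OF \<open>a < b\<close> \<open>A \<ge> 0\<close> \<open>M < m\<close> m])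
  finally show ?thesis .
qed

end
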